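(* Let $(\varrho^n,\boldsymbol u^n)_{0\le n\le N}$ be discrete solutions of the finite volume scheme described in the context, and assume that for every $0\le n\le N-1$ and every $K\in\mathcal T$: (1) $\eta\ge \dfrac{1}{\varrho^{n+1}_K}$; (2) $\delta t\le \dfrac{|K|\,\varrho^{n+1}_K}{2\displaystyle\sum_{\sigma\in\mathcal E(K),\,\sigma=K|L}|\sigma|\,\bigl(-F^{n+1,-}_{\sigma,K}\bigr)}$ (no restriction for those $K$ for which the denominator vanishes). Then there exists a constant $C>0$, independent of the space-time discretization, such that for every $1\le n\le N$ $$\sum_{K\in\mathcal T}|K|\,E^n_K+\sum_{r=0}^{n-1}\delta t^2\sum_{K\in\mathcal T}|K|\Bigl(\eta-\frac1{\varrho^{r+1}_K}\Bigr)\bigl|(\nabla_{\mathcal T}p^{r+1})_K\bigr|^2\;\le\;C,$$ where $E^n_K=\frac12\varrho^n_K|\boldsymbol u^n_K|^2+\psi_\gamma(\varrho^n_K)$.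
   Context: Data. $d\in\{1,2,3\}$; $\Omega\subset\mathbb R^d$ is bounded, and its closure is a finite union of closed rectangles ($d=2$) or closed parallelepipeds ($d=3$) (intervals if $d=1$). $a>0$, $\gamma>1$, $p(\varrho)=a\varrho^\gamma$, $\psi_\gamma(\varrho)=\frac{a}{\gamma-1}\varrho^\gamma$. Mesh. $\mathcal T$ is a finite tessellation of $\Omega$ into (possibly non-uniform) closed rectangles/parallelepipeds $K$ (control volumes), $\overline\Omega=\bigcup_{K\in\mathcal T}K$; $|K|$ is the $d$-dimensional Lebesgue measure. $\mathcal E$ is the set of all edges ($d=2$)/faces ($d=3$), $|\sigma|$ the $(d-1)$-dimensional measure of $\sigma\in\mathcal E$; $\mathcal E(K)$ are the edges of $K$; $\mathcal E_{int}$ and $\mathcal E_{ext}$ are the internal edges and those lying on $\partial\Omega$. An internal edge shared by $K,L$ is written $\sigma=K|L$. $\boldsymbol\nu_{\sigma,K}$ is the unit normal to $\sigma\in\mathcal E(K)$ pointing out of $K$. $\mathcal L_{\mathcal T}(\Omega)$ (resp. $\mathcal L_{\mathcal T}(\Omega;\mathbb R^d)$) is the space of scalar (resp. vector) functions constant on each $K\in\mathcal T$; $q_K$ is the value on $K$, and $\overline q_\sigma=\frac{q_K+q_L}{2}$ for $\sigma=K|L$. Operators. For $\boldsymbol w\in\mathcal L_{\mathcal T}(\Omega;\mathbb R^d)$: $w_{\sigma,K}=\overline{\boldsymbol w}_\sigma\cdot\boldsymbol\nu_{\sigma,K}$ if $\sigma=K|L$, and $w_{\sigma,K}=0$ if $\sigma\in\mathcal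 E(K)\cap\mathcal E_{ext}$. Discrete gradient: $(\nabla_{\mathcal T}q)_K=\frac1{|K|}\sum_{\sigma\in\mathcal E(K),\,\sigma=K|L}|\sigma|\frac{q_L-q_K}{2}\boldsymbol\nu_{\sigma,K}$. Upwind divergence: $(\mathrm{div}^{up}_{\mathcal T}(q,\boldsymbol v))_K=\frac1{|K|}\sum_{\sigma\in\mathcal E(K),\,\sigma=K|L}|\sigma|\bigl(q_K(v_{\sigma,K})^++q_L(v_{\sigma,K})^-\bigr)$, also applied componentwise to vector-valued $q$. Scheme. $0=t^0<\dots<t^N=T$ with constant step $\delta t=t^{n+1}-t^n$; $\eta>0$ is a parameter. Initial data $\varrho_0\in L^\infty(\Omega)$, $\varrho_0>0$ a.e., $\boldsymbol u_0\in L^\infty(\Omega;\mathbb R^d)$ (fixed independently of the discretization); $\varrho^0_K=\frac1{|K|}\int_K\varrho_0\,dx$, $\boldsymbol u^0_K=\frac1{|K|}\int_K\boldsymbol u_0\,dx$. A discrete solution is a family $(\varrho^n,\boldsymbol u^n)\in\mathcal L_{\mathcal T}(\Omega)\times\mathcal L_{\mathcal T}(\Omega;\mathbb R^d)$, $0\le n\le N$, with $\varrho^n>0$, such that for all $0\le n\le N-1$ and all $K\in\mathcal T$ $$\tfrac1{\delta t}(\varrho^{n+1}_K-\varrho^n_K)+(\mathrm{div}^{up}_{\mathcal T}(\varrho^{n+1},\boldsymbol v^n))_K=0,$$ $$\tfrac1{\delta t}(\varrho^{n+1}_K\boldsymbol u^{n+1}_K-\varrho^n_K\boldsymbol u^n_K)+(\mathrm{div}^{up}_{\mathcal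 T}(\varrho^{n+1}\boldsymbol u^n,\boldsymbol v^n))_K+(\nabla_{\mathcal T}p^{n+1})_K=0,$$ where $p^{n}_K=p(\varrho^{n}_K)$, $\boldsymbol v^n=\boldsymbol u^n-\delta\boldsymbol u^{n+1}$, $\delta\boldsymbol u^{n+1}_K=\eta\,\delta t\,(\nabla_{\mathcal T}p^{n+1})_K$. The signed parts of $v^n_{\sigma,K}$ are by definition $(v^n_{\sigma,K})^+=(u^n_{\sigma,K})^+-(\delta u^{n+1}_{\sigma,K})^-\ge0$ and $(v^n_{\sigma,K})^-=(u^n_{\sigma,K})^--(\delta u^{n+1}_{\sigma,K})^+\le0$, where on the right-hand sides $b^\pm=\frac{b\pm|b|}{2}$ for real $b$. Finally $F^{n+1,-}_{\sigma,K}=\varrho^{n+1}_L(v^n_{\sigma,K})^-\le 0$ for $\sigma=K|L$. *)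

theory Defs
  imports "HOL-Analysis.Analysis"
begin

section \<open>Domain and mesh\<close>

definition parallelotope :: "real^'d \<Rightarrow> ('d \<Rightarrow> real^'d) \<Rightarrow> (real^'d) set" where
  "parallelotope x b = {x + (\<Sum>i\<in>UNIV. t i *\<^sub>R b i) | t. \<forall>i. 0 \<le> t i \<and> t i \<le> 1}"

text \<open>Closed intervals (dimension 1), closed rectangles in any orientation (dimension 2),
  closed parallelepipeds, not necessarily rectangular (dimension 3).\<close>
definition control_volume :: "(real^'d) set \<Rightarrow> bool" where
  "control_volume K \<longleftrightarrow>
     (\<exists>x b. inj b \<and> independent (range b) \<and>
        (CARD('d) = 2 \<longrightarrow> (\<forall>i j. i \<noteq> j \<longrightarrow> b i \<bullet> b j = 0)) \<and>
        K = parallelotope x b)"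

text \<open>\<open>\<Omega>\<close> need not be open; measurability is what the Lebesgue spaces on \<open>\<Omega>\<close> presuppose.\<close>
definition admissible_domain :: "(real^'d) set \<Rightarrow> bool" where
  "admissible_domain \<Omega> \<longleftrightarrow>
     bounded \<Omega> \<and> \<Omega> \<in> sets lebesgue \<and>
     (\<exists>\<K>. finite \<K> \<and> (\<forall>K\<in>\<K>. control_volume K) \<and> closure \<Omega> = \<Union>\<K>)"

definition edges :: "(real^'d) set \<Rightarrow> (real^'d) set set" where
  "edges K = {\<sigma>. \<sigma> facet_of K}"

definition interior_edges :: "(real^'d) set \<Rightarrow> (real^'d) set \<Rightarrow> (real^'d) set set" where
  "interior_edges \<Omega> K = {\<sigma> \<in> edges K. \<not> \<sigma> \<subseteq> frontier \<Omega>}"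

text \<open>The last condition says that the mesh is conforming: an edge that does not lie on the
  boundary is a full edge of a second cell.  Disjointness of the interiors makes this second
  cell unique.\<close>
definition mesh :: "(real^'d) set \<Rightarrow> (real^'d) set set \<Rightarrow> bool" where
  "mesh \<Omega> \<T> \<longleftrightarrow>
     finite \<T> \<and> (\<forall>K\<in>\<T>. control_volume K) \<and> closure \<Omega> = \<Union>\<T> \<and>
     (\<forall>K\<in>\<T>. \<forall>L\<in>\<T>. K \<noteq> L \<longrightarrow> interior K \<inter> interior L = {}) \<and>
     (\<forall>K\<in>\<T>. \<forall>\<sigma>\<in>interior_edges \<Omega> K. \<exists>L\<in>\<T>. L \<noteq> K \<and> \<sigma> \<in> edges L)"

text \<open>The cell \<open>L\<close> with \<open>\<sigma> = K|L\<close>.\<close>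
definition neighbour :: "(real^'d) set set \<Rightarrow> (real^'d) set \<Rightarrow> (real^'d) set \<Rightarrow> (real^'d) set" where
  "neighbour \<T> \<sigma> K = (THE L. L \<in> \<T> \<and> L \<noteq> K \<and> \<sigma> \<in> edges L)"

definition outer_normal :: "(real^'d) set \<Rightarrow> (real^'d) set \<Rightarrow> real^'d" where
  "outer_normal \<sigma> K =
     (THE \<nu>. norm \<nu> = 1 \<and> (\<forall>x\<in>\<sigma>. \<forall>y\<in>\<sigma>. \<nu> \<bullet> (y - x) = 0) \<and>
        (\<forall>x\<in>\<sigma>. \<forall>y\<in>K. \<nu> \<bullet> (y - x) \<le> 0))"

text \<open>The \<open>(d-1)\<close>-dimensional measure of a flat set \<open>\<sigma>\<close> of codimension one, as the
  \<open>d\<close>-dimensional volume of the right prism of height 1 over \<open>\<sigma>\<close>.  The unit normal is determined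
  up to its sign, which only translates the prism.  For \<open>d = 1\<close> a point has measure 1.\<close>
definition edge_measure :: "(real^'d) set \<Rightarrow> real" where
  "edge_measure \<sigma> =
     (let \<nu> = (SOME \<nu>. norm \<nu> = 1 \<and> (\<forall>x\<in>\<sigma>. \<forall>y\<in>\<sigma>. \<nu> \<bullet> (y - x) = 0))
      in measure lebesgue {x + t *\<^sub>R \<nu> | x t. x \<in> \<sigma> \<and> 0 \<le> t \<and> t \<le> 1})"

section \<open>Discrete operators\<close>

text \<open>A function that is constant on each cell is represented by the map sending a cell \<open>K\<close>
  of the mesh to the value on \<open>K\<close>; values at sets that are not cells are irrelevant.\<close>

definition edge_trace ::
  "(real^'d) set \<Rightarrow> (real^'d) set set \<Rightarrow> ((real^'d) set \<Rightarrow> real^'d) \<Rightarrow>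
   (real^'d) set \<Rightarrow> (real^'d) set \<Rightarrow> real" where
  "edge_trace \<Omega> \<T> w \<sigma> K =
     (if \<sigma> \<in> interior_edges \<Omega> K
      then ((1/2) *\<^sub>R (w K + w (neighbour \<T> \<sigma> K))) \<bullet> outer_normal \<sigma> K else 0)"

definition grad ::
  "(real^'d) set \<Rightarrow> (real^'d) set set \<Rightarrow> ((real^'d) set \<Rightarrow> real) \<Rightarrow> (real^'d) set \<Rightarrow> real^'d" where
  "grad \<Omega> \<T> q K = (1 / measure lebesgue K) *\<^sub>R
     (\<Sum>\<sigma>\<in>interior_edges \<Omega> K.
        (edge_measure \<sigma> * ((q (neighbour \<T> \<sigma> K) - q K) / 2)) *\<^sub>R outer_normal \<sigma> K)"

definition pos_part :: "real \<Rightarrow> real" where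
  "pos_part b = (b + \<bar>b\<bar>) / 2"

definition neg_part :: "real \<Rightarrow> real" where
  "neg_part b = (b - \<bar>b\<bar>) / 2"

text \<open>The signed parts of the stabilised edge velocity \<open>v = u - du\<close> are not the positive and
  negative parts of the number \<open>v\<^bsub>\<sigma>,K\<^esub>\<close>, but are built from those of \<open>u\<close> and \<open>du\<close> separately.
  Their sum is \<open>v\<^bsub>\<sigma>,K\<^esub>\<close>.\<close>

definition v_plus ::
  "(real^'d) set \<Rightarrow> (real^'d) set set \<Rightarrow> ((real^'d) set \<Rightarrow> real^'d) \<Rightarrow> ((real^'d) set \<Rightarrow> real^'d) \<Rightarrow>
   (real^'d) set \<Rightarrow> (real^'d) set \<Rightarrow> real" where
  "v_plus \<Omega> \<T> u du \<sigma> K =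
     pos_part (edge_trace \<Omega> \<T> u \<sigma> K) - neg_part (edge_trace \<Omega> \<T> du \<sigma> K)"

definition v_minus ::
  "(real^'d) set \<Rightarrow> (real^'d) set set \<Rightarrow> ((real^'d) set \<Rightarrow> real^'d) \<Rightarrow> ((real^'d) set \<Rightarrow> real^'d) \<Rightarrow>
   (real^'d) set \<Rightarrow> (real^'d) set \<Rightarrow> real" where
  "v_minus \<Omega> \<T> u du \<sigma> K =
     neg_part (edge_trace \<Omega> \<T> u \<sigma> K) - pos_part (edge_trace \<Omega> \<T> du \<sigma> K)"

text \<open>Upwind divergence of \<open>q\<close> transported by \<open>v = u - du\<close>, for scalar and for vector-valued
  \<open>q\<close>.\<close>
definition div_up ::
  "(real^'d) set \<Rightarrow> (real^'d) set set \<Rightarrow> ((real^'d) set \<Rightarrow> 'b::real_vector) \<Rightarrow>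
   ((real^'d) set \<Rightarrow> real^'d) \<Rightarrow> ((real^'d) set \<Rightarrow> real^'d) \<Rightarrow> (real^'d) set \<Rightarrow> 'b" where
  "div_up \<Omega> \<T> q u du K = (1 / measure lebesgue K) *\<^sub>R
     (\<Sum>\<sigma>\<in>interior_edges \<Omega> K. edge_measure \<sigma> *\<^sub>R
        (v_plus \<Omega> \<T> u du \<sigma> K *\<^sub>R q K + v_minus \<Omega> \<T> u du \<sigma> K *\<^sub>R q (neighbour \<T> \<sigma> K)))"

section \<open>The scheme\<close>

definition pressure :: "real \<Rightarrow> real \<Rightarrow> real \<Rightarrow> real" where
  "pressure a \<gamma> r = a * r powr \<gamma>"

definition psi :: "real \<Rightarrow> real \<Rightarrow> real \<Rightarrow> real" where
  "psi a \<gamma> r = a / (\<gamma> - 1) * r powr \<gamma>"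

definition energy :: "real \<Rightarrow> real \<Rightarrow> real \<Rightarrow> real^'d \<Rightarrow> real" where
  "energy a \<gamma> r w = 1/2 * r * (norm w)\<^sup>2 + psi a \<gamma> r"

definition L_infinity :: "(real^'d) set \<Rightarrow> (real^'d \<Rightarrow> 'b::euclidean_space) \<Rightarrow> bool" where
  "L_infinity \<Omega> f \<longleftrightarrow>
     f \<in> borel_measurable (lebesgue_on \<Omega>) \<and> (\<exists>B. AE x in lebesgue_on \<Omega>. norm (f x) \<le> B)"

text \<open>The data are only given on \<open>\<Omega>\<close>, whereas a cell is contained in the closure of \<open>\<Omega>\<close>.\<close>
definition cell_mean ::
  "(real^'d) set \<Rightarrow> (real^'d \<Rightarrow> 'b::euclidean_space) \<Rightarrow> (real^'d) set \<Rightarrow> 'b" where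
  "cell_mean \<Omega> f K =
     (1 / measure lebesgue K) *\<^sub>R set_lebesgue_integral lebesgue (K \<inter> \<Omega>) f"

definition pressure_grad ::
  "(real^'d) set \<Rightarrow> (real^'d) set set \<Rightarrow> real \<Rightarrow> real \<Rightarrow> ((real^'d) set \<Rightarrow> real) \<Rightarrow>
   (real^'d) set \<Rightarrow> real^'d" where
  "pressure_grad \<Omega> \<T> a \<gamma> \<rho> = grad \<Omega> \<T> (\<lambda>K. pressure a \<gamma> (\<rho> K))"

text \<open>Here \<open>\<rho>\<close> is the density at the new time level.\<close>
definition velocity_correction ::
  "(real^'d) set \<Rightarrow> (real^'d) set set \<Rightarrow> real \<Rightarrow> real \<Rightarrow> real \<Rightarrow> real \<Rightarrow>
   ((real^'d) set \<Rightarrow> real) \<Rightarrow> (real^'d) set \<Rightarrow> real^'d" where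
  "velocity_correction \<Omega> \<T> a \<gamma> \<eta> \<delta>t \<rho> K = (\<eta> * \<delta>t) *\<^sub>R pressure_grad \<Omega> \<T> a \<gamma> \<rho> K"

definition discrete_solution ::
  "(real^'d) set \<Rightarrow> (real^'d) set set \<Rightarrow> real \<Rightarrow> real \<Rightarrow> real \<Rightarrow> real \<Rightarrow> nat \<Rightarrow>
   (real^'d \<Rightarrow> real) \<Rightarrow> (real^'d \<Rightarrow> real^'d) \<Rightarrow>
   (nat \<Rightarrow> (real^'d) set \<Rightarrow> real) \<Rightarrow> (nat \<Rightarrow> (real^'d) set \<Rightarrow> real^'d) \<Rightarrow> bool" where
  "discrete_solution \<Omega> \<T> a \<gamma> \<eta> \<delta>t N \<rho>0 u0 \<rho> u \<longleftrightarrow>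
     (\<forall>K\<in>\<T>. \<rho> 0 K = cell_mean \<Omega> \<rho>0 K \<and> u 0 K = cell_mean \<Omega> u0 K) \<and>
     (\<forall>n\<le>N. \<forall>K\<in>\<T>. \<rho> n K > 0) \<and>
     (\<forall>n<N. \<forall>K\<in>\<T>.
        (let du = velocity_correction \<Omega> \<T> a \<gamma> \<eta> \<delta>t (\<rho> (Suc n)) in
         (1 / \<delta>t) * (\<rho> (Suc n) K - \<rho> n K) + div_up \<Omega> \<T> (\<rho> (Suc n)) (u n) du K = 0 \<and>
         (1 / \<delta>t) *\<^sub>R (\<rho> (Suc n) K *\<^sub>R u (Suc n) K - \<rho> n K *\<^sub>R u n K)
           + div_up \<Omega> \<T> (\<lambda>L. \<rho> (Suc n) L *\<^sub>R u n L) (u n) du K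
           + pressure_grad \<Omega> \<T> a \<gamma> (\<rho> (Suc n)) K = 0))"

text \<open>The negative part of the mass flux; \<open>\<rho>\<close> is the density at the new time level, \<open>u\<close> the
  velocity at the old one.\<close>
definition mass_flux_minus ::
  "(real^'d) set \<Rightarrow> (real^'d) set set \<Rightarrow> real \<Rightarrow> real \<Rightarrow> real \<Rightarrow> real \<Rightarrow>
   ((real^'d) set \<Rightarrow> real) \<Rightarrow> ((real^'d) set \<Rightarrow> real^'d) \<Rightarrow>
   (real^'d) set \<Rightarrow> (real^'d) set \<Rightarrow> real" where
  "mass_flux_minus \<Omega> \<T> a \<gamma> \<eta> \<delta>t \<rho> u \<sigma> K =
     \<rho> (neighbour \<T> \<sigma> K) * v_minus \<Omega> \<T> u (velocity_correction \<Omega> \<T> a \<gamma> \<eta> \<delta>t \<rho>) \<sigma> K"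

end

theory Submission imports Defs begin

text \<open>
  The total energy decreases from one time level to the next, so it is bounded by its initial
  value.  Test the momentum equation with \<open>u\<^sup>n\<close> and the mass equation with
  \<open>\<psi>'(\<rho>\<^bsup>n+1\<^esup>) - |u\<^sup>n|\<^sup>2/2\<close>.  The flux terms are antisymmetric across each interior edge and cancel
  in the sum over the cells, and convexity of \<open>\<psi>\<close> gives the right sign of the upwind error in the
  internal energy.  The explicit time error \<open>\<rho>\<^bsup>n+1\<^esup> |u\<^bsup>n+1\<^esup> - u\<^sup>n|\<^sup>2/2\<close> is split by the momentum equation
  into a pressure gradient part and an upwind part.  By Cauchy-Schwarz and the restriction on the
  time step, the upwind part is absorbed by the upwind dissipation of kinetic energy.  The work of
  the pressure against \<open>u\<^sup>n\<close> cancels by discrete duality, and the velocity correction leaves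
  \<open>-\<eta> \<delta>t\<^sup>2 |\<nabla>p|\<^sup>2\<close>, which is paired with the remaining \<open>\<delta>t\<^sup>2 |\<nabla>p|\<^sup>2 / \<rho>\<^bsup>n+1\<^esup>\<close>.
\<close>

section \<open>Edges and their normals\<close>

text \<open>The hull lies in the hyperplane orthogonal to \<open>\<nu>\<close>; both are affine of
  codimension one, and nested affine sets of equal dimension coincide.\<close>

lemma normal_affine_hull:
  fixes \<sigma> :: "'a::euclidean_space set"
  assumes "norm \<nu> = 1" "\<forall>x\<in>\<sigma>. \<forall>y\<in>\<sigma>. \<nu> \<bullet> (y - x) = 0" "aff_dim \<sigma> = int DIM('a) - 1" "x \<in> \<sigma>"
  shows "affine hull \<sigma> = {y. \<nu> \<bullet> y = \<nu> \<bullet> x}"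
proof (rule affine_dim_equal)
  show "affine hull \<sigma> \<noteq> {}" using assms(4) by auto
  have "\<nu> \<bullet> (y - x) = 0" if "y \<in> \<sigma>" for y
    using assms(2,4) that by blast
  then show "affine hull \<sigma> \<subseteq> {y. \<nu> \<bullet> y = \<nu> \<bullet> x}"
    by (intro hull_minimal) (auto simp: inner_diff_right affine_hyperplane)
  have "\<nu> \<noteq> 0" using assms(1) by auto
  then show "aff_dim (affine hull \<sigma>) = aff_dim {y. \<nu> \<bullet> y = \<nu> \<bullet> x}"
    using assms(3) by (simp add: aff_dim_hyperplane)
qed (auto simp: affine_hyperplane)

text \<open>The affine hull of \<open>\<sigma>\<close> is the hyperplane of either vector. The part
  of \<open>\<nu>'\<close> orthogonal to \<open>\<nu>\<close> is a direction of this hyperplane, so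
  it is orthogonal to \<open>\<nu>'\<close> as well. This forces \<open>c * c = 1\<close>, the
  equality case of Cauchy-Schwarz.\<close>

lemma unit_normal_unique_up_to_sign:
  fixes \<sigma> :: "'a::euclidean_space set"
  assumes "norm \<nu> = 1" "\<forall>x\<in>\<sigma>. \<forall>y\<in>\<sigma>. \<nu> \<bullet> (y - x) = 0"
    and "norm \<nu>' = 1" "\<forall>x\<in>\<sigma>. \<forall>y\<in>\<sigma>. \<nu>' \<bullet> (y - x) = 0"
    and "aff_dim \<sigma> = int DIM('a) - 1" "\<sigma> \<noteq> {}"
  shows "\<nu>' = \<nu> \<or> \<nu>' = - \<nu>"
proof -
  obtain x where x: "x \<in> \<sigma>" using assms(6) by auto
  define c where "c = \<nu> \<bullet> \<nu>'"
  have n: "\<nu> \<bullet> \<nu> = 1" "\<nu>' \<bullet> \<nu>' = 1"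
    using assms(1,3) by (simp_all add: dot_square_norm)
  have "x + (\<nu>' - c *\<^sub>R \<nu>) \<in> {y. \<nu> \<bullet> y = \<nu> \<bullet> x}"
    by (simp add: inner_add_right inner_diff_right n c_def)
  then have "x + (\<nu>' - c *\<^sub>R \<nu>) \<in> {y. \<nu>' \<bullet> y = \<nu>' \<bullet> x}"
    using normal_affine_hull[OF assms(1,2,5) x] normal_affine_hull[OF assms(3,4,5) x] by simp
  then have c: "c * c = 1"
    by (simp add: inner_add_right inner_diff_right n c_def inner_commute)
  have "(\<nu>' - c *\<^sub>R \<nu>) \<bullet> (\<nu>' - c *\<^sub>R \<nu>) = 0"
    using c by (simp add: algebra_simps n c_def inner_commute)
  then have "\<nu>' = c *\<^sub>R \<nu>" by simp
  moreover have "c = 1 \<or> c = - 1" using c by (simp add: square_eq_1_iff)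
  ultimately show ?thesis by auto
qed

lemma halfspace_strict_interior:
  fixes K :: "'a::euclidean_space set"
  assumes "norm \<nu> = 1" "\<forall>x\<in>\<sigma>. \<forall>y\<in>K. \<nu> \<bullet> (y - x) \<le> 0" "x \<in> \<sigma>" "y \<in> interior K"
  shows "\<nu> \<bullet> y < \<nu> \<bullet> x"
proof -
  have "K \<subseteq> {z. \<nu> \<bullet> z \<le> \<nu> \<bullet> x}"
    using assms(2,3) by (auto simp: inner_diff_right)
  then have "interior K \<subseteq> interior {z. \<nu> \<bullet> z \<le> \<nu> \<bullet> x}" by (rule interior_mono)
  moreover have "\<nu> \<noteq> 0" using assms(1) by auto
  ultimately show ?thesis using assms(4) by auto
qed

text \<open>The point \<open>x - t *\<^sub>R \<nu>\<close> is a convex combination of an interior point of \<open>K\<close> and a point \<open>x' t\<close> of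
  the hyperplane through \<open>\<sigma>\<close> that tends to \<open>x\<close>, hence lies in \<open>\<sigma>\<close> for small \<open>t\<close>.\<close>
lemma eventually_inward_in_interior:
  fixes K :: "'a::euclidean_space set"
  assumes "convex K" "interior K \<noteq> {}" "\<sigma> \<subseteq> K" "aff_dim \<sigma> = int DIM('a) - 1"
    and \<nu>: "norm \<nu> = 1" "\<forall>x\<in>\<sigma>. \<forall>y\<in>\<sigma>. \<nu> \<bullet> (y - x) = 0" "\<forall>x\<in>\<sigma>. \<forall>y\<in>K. \<nu> \<bullet> (y - x) \<le> 0"
    and x: "x \<in> rel_interior \<sigma>"
  shows "\<forall>\<^sub>F t in at_right 0. x - t *\<^sub>R \<nu> \<in> interior K"
proof -
  obtain y where y: "y \<in> interior K" using assms(2) by auto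
  obtain e where e: "e > 0" "ball x e \<inter> affine hull \<sigma> \<subseteq> \<sigma>" and x\<sigma>: "x \<in> \<sigma>"
    using x by (auto simp: mem_rel_interior_ball)
  have hull: "affine hull \<sigma> = {z. \<nu> \<bullet> z = \<nu> \<bullet> x}"
    by (rule normal_affine_hull[OF \<nu>(1,2) assms(4) x\<sigma>])
  define h where "h = \<nu> \<bullet> x - \<nu> \<bullet> y"
  have h: "h > 0"
    using halfspace_strict_interior[OF \<nu>(1,3) x\<sigma> y] by (simp add: h_def)
  have \<nu>\<nu>: "\<nu> \<bullet> \<nu> = 1" using \<nu>(1) by (simp add: dot_square_norm)
  \<comment> \<open>Obtained by solving \<open>x - t *\<^sub>R \<nu> = (1 - t / h) *\<^sub>R x' t +
    (t / h) *\<^sub>R y\<close>. The point \<open>y\<close> has depth \<open>h\<close> below the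
    hyperplane, so the weight \<open>t / h\<close> is the one that puts \<open>x' t\<close> on
    it.\<close>
  define x' where "x' t = (1 / (1 - t / h)) *\<^sub>R (x - t *\<^sub>R \<nu> - (t / h) *\<^sub>R y)" for t
  have "(x' \<longlongrightarrow> (1 / (1 - 0 / h)) *\<^sub>R (x - 0 *\<^sub>R \<nu> - (0 / h) *\<^sub>R y)) (at_right 0)"
    unfolding x'_def by (intro tendsto_intros) (use h in auto)
  then have "(x' \<longlongrightarrow> x) (at_right 0)" by simp
  then have "\<forall>\<^sub>F t in at_right 0. dist (x' t) x < e"
    using e(1) by (rule tendstoD)
  moreover have "\<forall>\<^sub>F t in at_right 0. t \<in> {0<..<h}"
    using h by (rule eventually_at_right_real)
  ultimately show ?thesis
  proof eventually_elim
    case (elim t)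
    define s where "s = t / h"
    have s: "0 < s" "s < 1" "s * h = t" using elim h by (auto simp: s_def)
    have "\<nu> \<bullet> x' t = (1 / (1 - s)) * (\<nu> \<bullet> x - t - s * (\<nu> \<bullet> x - h))"
      by (simp add: x'_def s_def h_def inner_diff_right \<nu>\<nu>)
    also have "\<nu> \<bullet> x - t - s * (\<nu> \<bullet> x - h) = (1 - s) * (\<nu> \<bullet> x)"
      using s(3) by (simp add: algebra_simps)
    finally have "\<nu> \<bullet> x' t = \<nu> \<bullet> x" using s by simp
    then have "x' t \<in> K"
      using e(2) hull elim(1) assms(3) by (auto simp: dist_commute)
    from mem_interior_convex_shrink[OF assms(1) y this s(1)]
    have "x' t - s *\<^sub>R (x' t - y) \<in> interior K" using s by simp
    moreover have "x' t - s *\<^sub>R (x' t - y) = (1 - s) *\<^sub>R x' t + s *\<^sub>R y"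
      by (simp add: algebra_simps)
    moreover have "(1 - s) *\<^sub>R x' t = x - t *\<^sub>R \<nu> - s *\<^sub>R y"
      using s by (simp add: x'_def s_def[symmetric])
    ultimately show ?case by simp
  qed
qed

text \<open>From a relative interior point of \<open>\<sigma>\<close>, a short move along
  \<open>- \<nu>\<close> enters both interiors at once. In a mesh this rules out two distinct cells
  on the same side of a common edge.\<close>

lemma same_side_interiors_meet:
  fixes K L :: "'a::euclidean_space set"
  assumes "convex K" "interior K \<noteq> {}" "\<sigma> \<subseteq> K" "convex L" "interior L \<noteq> {}" "\<sigma> \<subseteq> L"
    and "convex \<sigma>" "\<sigma> \<noteq> {}" "aff_dim \<sigma> = int DIM('a) - 1"
    and "norm \<nu> = 1" "\<forall>x\<in>\<sigma>. \<forall>y\<in>\<sigma>. \<nu> \<bullet> (y - x) = 0"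
    and "\<forall>x\<in>\<sigma>. \<forall>y\<in>K. \<nu> \<bullet> (y - x) \<le> 0" "\<forall>x\<in>\<sigma>. \<forall>y\<in>L. \<nu> \<bullet> (y - x) \<le> 0"
  shows "interior K \<inter> interior L \<noteq> {}"
proof -
  obtain x where x: "x \<in> rel_interior \<sigma>"
    using assms(7,8) rel_interior_eq_empty by blast
  have "\<forall>\<^sub>F t in at_right (0::real). x - t *\<^sub>R \<nu> \<in> interior K \<and> x - t *\<^sub>R \<nu> \<in> interior L"
    using eventually_inward_in_interior[OF assms(1-3,9-12) x]
      eventually_inward_in_interior[OF assms(4-6,9-11,13) x]
    by (rule eventually_conj)
  then obtain t where "x - t *\<^sub>R \<nu> \<in> interior K \<and> x - t *\<^sub>R \<nu> \<in> interior L"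
    using eventually_happens'[OF trivial_limit_at_right_real] by blast
  then show ?thesis by blast
qed

section \<open>Control volumes as polytopes with nonempty interior\<close>

lemma control_volume_polytope:
  fixes K :: "(real^'d) set"
  assumes "control_volume K"
  shows "polytope K" and "interior K \<noteq> {}"
proof -
  obtain x and b :: "'d \<Rightarrow> real^'d" where b: "inj b" "independent (range b)"
    and K: "K = parallelotope x b"
    using assms by (auto simp: control_volume_def)
  \<comment> \<open>Up to the translation by \<open>x\<close>, the cell is the image of the unit
    cube under this linear map, so polytopality and the interior are inherited from the cube once
    \<open>f\<close> is injective.\<close>
  define f where "f = (\<lambda>t :: real^'d. \<Sum>i\<in>UNIV. t $ i *\<^sub>R b i)"
  have lin: "linear f"
    unfolding f_def by (rule linearI) (simp_all add: scaleR_add_left sum.distrib scaleR_sum_right)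
  have "t = 0" if "f t = 0" for t
  proof -
    \<comment> \<open>Independence concerns the set \<open>range b\<close>, so the coefficients are
      re-indexed by vectors through \<open>inv b\<close>.\<close>
    have "(\<Sum>v\<in>range b. t $ inv b v *\<^sub>R v) = 0"
      using that b(1) by (simp add: f_def sum.reindex)
    then have "\<forall>v\<in>range b. t $ inv b v = 0"
      using b(2)[unfolded independent_explicit, THEN conjunct2, THEN spec, of "\<lambda>v. t $ inv b v"]
      by (rule rev_mp)
    then show ?thesis using b(1) by (simp add: vec_eq_iff)
  qed
  then have inj: "inj f" using lin by (simp add: linear_injective_0)
  have K': "K = (+) x ` f ` cbox 0 1"
  proof
    show "K \<subseteq> (+) x ` f ` cbox 0 1"
    proof
      fix y assume "y \<in> K"
      then obtain t where t: "\<forall>i. 0 \<le> t i \<and> t i \<le> 1" "y = x + (\<Sum>i\<in>UNIV. t i *\<^sub>R b i)"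
        by (auto simp: K parallelotope_def)
      then show "y \<in> (+) x ` f ` cbox 0 1"
        by (intro image_eqI[of _ _ "f (vec_lambda t)"] image_eqI[of _ _ "vec_lambda t"])
          (auto simp: f_def mem_box_cart)
    qed
    show "(+) x ` f ` cbox 0 1 \<subseteq> K"
      by (auto simp: K parallelotope_def f_def mem_box_cart)
  qed
  show "polytope K"
    using polytope_linear_image[OF lin polytope_interval] by (simp add: K' polytope_translation_eq)
  have "box 0 (1 :: real^'d) \<noteq> {}" by (auto simp: interval_ne_empty_cart)
  then show "interior K \<noteq> {}"
    by (simp add: K' interior_translation interior_injective_linear_image[OF lin inj])
qed

section \<open>Existence, uniqueness and orientation of the outward normal\<close>

text \<open>The property inside the definite description \<open>outer_normal\<close>, isolated so
  that existence and uniqueness can be settled before the description is used.\<close>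

definition outward_unit_normal :: "'a::euclidean_space set \<Rightarrow> 'a set \<Rightarrow> 'a \<Rightarrow> bool" where
  "outward_unit_normal \<sigma> K \<nu> \<longleftrightarrow> norm \<nu> = 1 \<and> (\<forall>x\<in>\<sigma>. \<forall>y\<in>\<sigma>. \<nu> \<bullet> (y - x) = 0) \<and>
     (\<forall>x\<in>\<sigma>. \<forall>y\<in>K. \<nu> \<bullet> (y - x) \<le> 0)"

lemma edge_of_control_volume:
  fixes K :: "(real^'d) set"
  assumes "control_volume K" "\<sigma> \<in> edges K"
  shows "convex \<sigma>" "\<sigma> \<noteq> {}" "aff_dim \<sigma> = int DIM(real^'d) - 1" "\<sigma> \<subseteq> K"
proof -
  have f: "\<sigma> facet_of K" using assms(2) by (simp add: edges_def)
  have "aff_dim K = int DIM(real^'d)"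
    using control_volume_polytope(2)[OF assms(1)] aff_dim_nonempty_interior by blast
  then show "aff_dim \<sigma> = int DIM(real^'d) - 1" using f by (simp add: facet_of_def)
  show "convex \<sigma>" "\<sigma> \<noteq> {}" "\<sigma> \<subseteq> K"
    using f by (auto simp: facet_of_def face_of_imp_convex face_of_imp_subset)
qed

text \<open>A facet of a polyhedron is cut out by a supporting hyperplane, whose normal only has to
  be scaled to length one.\<close>

lemma outward_unit_normal_exists:
  fixes K :: "(real^'d) set"
  assumes "control_volume K" "\<sigma> \<in> edges K"
  shows "\<exists>\<nu>. outward_unit_normal \<sigma> K \<nu>"
proof -
  obtain a b where a: "a \<noteq> 0" "K \<subseteq> {x. a \<bullet> x \<le> b}" "\<sigma> = K \<inter> {x. a \<bullet> x = b}"
    using facet_of_polyhedron[of K \<sigma>] control_volume_polytope(1)[OF assms(1)] assms(2)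
    by (auto simp: edges_def polytope_imp_polyhedron)
  have "outward_unit_normal \<sigma> K (a /\<^sub>R norm a)"
    using a by (auto simp: outward_unit_normal_def inner_diff_right divide_right_mono
        mult_left_mono)
  then show ?thesis by blast
qed

lemma outward_unit_normal_same_side:
  fixes K L :: "(real^'d) set"
  assumes "control_volume K" "control_volume L" "\<sigma> \<in> edges K" "\<sigma> \<in> edges L"
    and "outward_unit_normal \<sigma> K \<nu>" "outward_unit_normal \<sigma> L \<nu>"
  shows "interior K \<inter> interior L \<noteq> {}"
proof -
  note e = edge_of_control_volume[OF assms(1,3)] edge_of_control_volume(4)[OF assms(2,4)]
  note p = control_volume_polytope[OF assms(1)] control_volume_polytope[OF assms(2)]
  show ?thesis
    by (rule same_side_interiors_meet[of K \<sigma> L \<nu>])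
      (use e p assms(5,6) in \<open>auto simp: outward_unit_normal_def polytope_imp_convex\<close>)
qed

lemma outward_unit_normal_cases:
  fixes K L :: "(real^'d) set"
  assumes "control_volume K" "\<sigma> \<in> edges K"
    and "outward_unit_normal \<sigma> K \<nu>" "outward_unit_normal \<sigma> L \<nu>'"
  shows "\<nu>' = \<nu> \<or> \<nu>' = - \<nu>"
  using assms(3,4) edge_of_control_volume(2,3)[OF assms(1,2)]
    unit_normal_unique_up_to_sign[of \<nu> \<sigma> \<nu>']
  unfolding outward_unit_normal_def by blast

text \<open>If the opposite vector were outward as well, an interior point of \<open>K\<close> would
  lie strictly on both sides of the hyperplane of \<open>\<sigma>\<close>.\<close>

lemma outward_unit_normal_unique:
  fixes K :: "(real^'d) set"
  assumes "control_volume K" "\<sigma> \<in> edges K"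
    and "outward_unit_normal \<sigma> K \<nu>" "outward_unit_normal \<sigma> K \<nu>'"
  shows "\<nu>' = \<nu>"
proof (rule ccontr)
  assume "\<nu>' \<noteq> \<nu>"
  then have neg: "\<nu>' = - \<nu>" using outward_unit_normal_cases[OF assms] by blast
  obtain x where "x \<in> \<sigma>" using edge_of_control_volume[OF assms(1,2)] by auto
  moreover obtain y where "y \<in> interior K" using control_volume_polytope[OF assms(1)] by auto
  ultimately have "\<nu> \<bullet> y < \<nu> \<bullet> x" "\<nu>' \<bullet> y < \<nu>' \<bullet> x"
    using assms(3,4) halfspace_strict_interior[of _ \<sigma> K x y]
    unfolding outward_unit_normal_def by blast+
  then show False by (simp add: neg)
qed

lemma outer_normal_outward:
  fixes K :: "(real^'d) set"
  assumes "control_volume K" "\<sigma> \<in> edges K"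
  shows "outward_unit_normal \<sigma> K (outer_normal \<sigma> K)"
proof -
  have "\<exists>!\<nu>. outward_unit_normal \<sigma> K \<nu>"
    using outward_unit_normal_exists[OF assms] outward_unit_normal_unique[OF assms] by blast
  then have "outward_unit_normal \<sigma> K (THE \<nu>. outward_unit_normal \<sigma> K \<nu>)" by (rule theI')
  then show ?thesis by (simp add: outer_normal_def outward_unit_normal_def)
qed

text \<open>The two normals agree up to sign, and equal ones would put both cells on the same side
  of \<open>\<sigma>\<close>, where their interiors meet.\<close>

lemma outer_normal_opposite:
  fixes K L :: "(real^'d) set"
  assumes "control_volume K" "control_volume L" "\<sigma> \<in> edges K" "\<sigma> \<in> edges L"
    and "interior K \<inter> interior L = {}"
  shows "outer_normal \<sigma> L = - outer_normal \<sigma> K"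
proof -
  note K = outer_normal_outward[OF assms(1,3)] and L = outer_normal_outward[OF assms(2,4)]
  have "outer_normal \<sigma> L \<noteq> outer_normal \<sigma> K"
    using outward_unit_normal_same_side[OF assms(1-4) K] L assms(5) by auto
  then show ?thesis
    using outward_unit_normal_cases[OF assms(1,3) K L] by blast
qed

text \<open>Justifies the definite description \<open>neighbour\<close>: conformity gives existence,
  disjoint interiors give uniqueness. Crossing an interior edge thus becomes an involution that
  reverses the normal, which is what all cancellations across edges rest on.\<close>

lemma mesh_neighbour:
  assumes "mesh \<Omega> \<T>" "K \<in> \<T>" "\<sigma> \<in> interior_edges \<Omega> K"
  shows "neighbour \<T> \<sigma> K \<in> \<T>" "neighbour \<T> \<sigma> K \<noteq> K" "\<sigma> \<in> interior_edges \<Omega> (neighbour \<T> \<sigma> K)"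
    "neighbour \<T> \<sigma> (neighbour \<T> \<sigma> K) = K"
    "outer_normal \<sigma> (neighbour \<T> \<sigma> K) = - outer_normal \<sigma> K"
proof -
  have cv: "\<And>K. K \<in> \<T> \<Longrightarrow> control_volume K"
    and dj: "\<And>K L. K \<in> \<T> \<Longrightarrow> L \<in> \<T> \<Longrightarrow> K \<noteq> L \<Longrightarrow> interior K \<inter> interior L = {}"
    using assms(1) by (auto simp: mesh_def)
  have e: "\<sigma> \<in> edges K" using assms(3) by (simp add: interior_edges_def)
  text \<open>Among three cells with a common edge, two lie on the same side of it.\<close>
  have two: "L = M" if "K \<in> \<T>" "L \<in> \<T>" "M \<in> \<T>" "\<sigma> \<in> edges K" "\<sigma> \<in> edges L" "\<sigma> \<in> edges M"
    "L \<noteq> K" "M \<noteq> K" for K L M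
  proof (rule ccontr)
    assume LM: "L \<noteq> M"
    have "outer_normal \<sigma> M = - outer_normal \<sigma> L" "outer_normal \<sigma> L = - outer_normal \<sigma> K"
      "outer_normal \<sigma> M = - outer_normal \<sigma> K"
      by (rule outer_normal_opposite; use that LM cv dj in auto)+
    then have "outer_normal \<sigma> K + outer_normal \<sigma> K = 0"
      by (metis add.right_inverse minus_minus)
    then have "outer_normal \<sigma> K = 0"
      by (simp flip: scaleR_2)
    then show False
      using outer_normal_outward[OF cv[OF \<open>K \<in> \<T>\<close>] \<open>\<sigma> \<in> edges K\<close>]
      by (simp add: outward_unit_normal_def)
  qed
  have "\<forall>K\<in>\<T>. \<forall>\<sigma>\<in>interior_edges \<Omega> K. \<exists>L\<in>\<T>. L \<noteq> K \<and> \<sigma> \<in> edges L"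
    using assms(1) by (simp add: mesh_def)
  then obtain L where L: "L \<in> \<T>" "L \<noteq> K" "\<sigma> \<in> edges L"
    using assms(2,3) by blast
  have n: "neighbour \<T> \<sigma> K = L"
    unfolding neighbour_def using L two[of K] e assms(2) by (intro the_equality) auto
  have "neighbour \<T> \<sigma> L = K"
    unfolding neighbour_def using L two[of L] e assms(2) by (intro the_equality) auto
  moreover have "outer_normal \<sigma> L = - outer_normal \<sigma> K"
    by (rule outer_normal_opposite) (use L e assms(2) cv dj in auto)
  ultimately show "neighbour \<T> \<sigma> K \<in> \<T>" "neighbour \<T> \<sigma> K \<noteq> K"
    "\<sigma> \<in> interior_edges \<Omega> (neighbour \<T> \<sigma> K)" "neighbour \<T> \<sigma> (neighbour \<T> \<sigma> K) = K"
    "outer_normal \<sigma> (neighbour \<T> \<sigma> K) = - outer_normal \<sigma> K"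
    using n L assms(3) by (auto simp: interior_edges_def)
qed

section \<open>Summation over cells and their interior edges\<close>

lemma finite_interior_edges:
  assumes "control_volume K"
  shows "finite (interior_edges \<Omega> K)"
  using finite_polytope_facets[OF control_volume_polytope(1)[OF assms]]
  by (simp add: interior_edges_def edges_def)

text \<open>Replacing \<open>(K, \<sigma>)\<close> by
  \<open>(neighbour \<T> \<sigma> K, \<sigma>)\<close> permutes the pairs of a cell and an interior
  edge of it, and changes the sign of every summand. The sum therefore equals its own
  negative.\<close>

lemma sum_antisymmetric_fluxes:
  fixes f :: "(real^'d) set \<Rightarrow> (real^'d) set \<Rightarrow> real"
  assumes mesh: "mesh \<Omega> \<T>"
    and f: "\<And>K \<sigma>. K \<in> \<T> \<Longrightarrow> \<sigma> \<in> interior_edges \<Omega> K \<Longrightarrow> f (neighbour \<T> \<sigma> K) \<sigma> = - f K \<sigma>"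
  shows "(\<Sum>K\<in>\<T>. \<Sum>\<sigma>\<in>interior_edges \<Omega> K. f K \<sigma>) = 0"
proof -
  define P where "P = Sigma \<T> (interior_edges \<Omega>)"
  define g where "g = (\<lambda>(K, \<sigma>). (neighbour \<T> \<sigma> K, \<sigma>))"
  have "finite \<T>" "\<forall>K\<in>\<T>. finite (interior_edges \<Omega> K)"
    using mesh by (auto simp: mesh_def finite_interior_edges)
  then have S: "(\<Sum>K\<in>\<T>. \<Sum>\<sigma>\<in>interior_edges \<Omega> K. f K \<sigma>) = (\<Sum>(K,\<sigma>)\<in>P. f K \<sigma>)"
    unfolding P_def by (rule sum.Sigma)
  have "(\<Sum>(K,\<sigma>)\<in>P. f K \<sigma>) = (\<Sum>(K,\<sigma>)\<in>P. - f K \<sigma>)"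
    by (rule sum.reindex_bij_witness[of _ g g])
      (auto simp: P_def g_def f mesh_neighbour[OF mesh])
  then show ?thesis by (simp add: S sum_negf case_prod_unfold)
qed


section \<open>Fluxes\<close>

lemma control_volume_measure_pos:
  fixes K :: "(real^'d) set"
  assumes "control_volume K"
  shows "K \<in> lmeasurable" "measure lebesgue K > 0"
proof -
  note p = control_volume_polytope[OF assms]
  show lm: "K \<in> lmeasurable"
    using p(1) by (intro lmeasurable_compact polytope_imp_compact)
  have "\<not> negligible K"
    using p by (simp add: negligible_convex_interior polytope_imp_convex)
  then have "measure lebesgue K \<noteq> 0" using lm by (simp add: negligible_iff_measure)
  then show "measure lebesgue K > 0" by (simp add: zero_less_measure_iff)
qed

lemma edge_measure_nonneg: "edge_measure \<sigma> \<ge> 0"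
  by (simp add: edge_measure_def Let_def)

lemma pos_part_nonneg: "pos_part b \<ge> 0"
  and neg_part_nonpos: "neg_part b \<le> 0"
  and pos_part_minus: "pos_part (- b) = - neg_part b"
  and neg_part_minus: "neg_part (- b) = - pos_part b"
  and pos_part_add_neg_part: "pos_part b + neg_part b = b"
  by (auto simp: pos_part_def neg_part_def field_simps)

lemma v_plus_nonneg: "v_plus \<Omega> \<T> u du \<sigma> K \<ge> 0"
  using pos_part_nonneg[of "edge_trace \<Omega> \<T> u \<sigma> K"] neg_part_nonpos[of "edge_trace \<Omega> \<T> du \<sigma> K"]
  by (simp add: v_plus_def)

lemma v_minus_nonpos: "v_minus \<Omega> \<T> u du \<sigma> K \<le> 0"
  using neg_part_nonpos[of "edge_trace \<Omega> \<T> u \<sigma> K"] pos_part_nonneg[of "edge_trace \<Omega> \<T> du \<sigma> K"]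
  by (simp add: v_minus_def)

lemma v_plus_add_v_minus:
  "v_plus \<Omega> \<T> u du \<sigma> K + v_minus \<Omega> \<T> u du \<sigma> K = edge_trace \<Omega> \<T> u \<sigma> K - edge_trace \<Omega> \<T> du \<sigma> K"
  using pos_part_add_neg_part[of "edge_trace \<Omega> \<T> u \<sigma> K"]
    pos_part_add_neg_part[of "edge_trace \<Omega> \<T> du \<sigma> K"]
  by (simp add: v_plus_def v_minus_def)

lemma edge_trace_neighbour:
  assumes "mesh \<Omega> \<T>" "K \<in> \<T>" "\<sigma> \<in> interior_edges \<Omega> K"
  shows "edge_trace \<Omega> \<T> w \<sigma> (neighbour \<T> \<sigma> K) = - edge_trace \<Omega> \<T> w \<sigma> K"
  using assms(3) mesh_neighbour[OF assms] by (simp add: edge_trace_def add.commute)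

text \<open>The normal changes sign across the edge, which exchanges positive and negative parts:
  outflow seen from one side is inflow seen from the other.\<close>

lemma v_plus_neighbour:
  assumes "mesh \<Omega> \<T>" "K \<in> \<T>" "\<sigma> \<in> interior_edges \<Omega> K"
  shows "v_plus \<Omega> \<T> u du \<sigma> (neighbour \<T> \<sigma> K) = - v_minus \<Omega> \<T> u du \<sigma> K"
  by (simp add: v_plus_def v_minus_def edge_trace_neighbour[OF assms] pos_part_minus neg_part_minus)

lemma v_minus_neighbour:
  assumes "mesh \<Omega> \<T>" "K \<in> \<T>" "\<sigma> \<in> interior_edges \<Omega> K"
  shows "v_minus \<Omega> \<T> u du \<sigma> (neighbour \<T> \<sigma> K) = - v_plus \<Omega> \<T> u du \<sigma> K"
  by (simp add: v_plus_def v_minus_def edge_trace_neighbour[OF assms] pos_part_minus neg_part_minus)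

text \<open>Conservativity of the upwind flux. It will be applied with \<open>q\<close> equal to the
  density times the squared speed, and with \<open>q\<close> equal to the internal energy.\<close>

lemma sum_upwind_fluxes:
  fixes q :: "(real^'d) set \<Rightarrow> real"
  assumes "mesh \<Omega> \<T>"
  shows "(\<Sum>K\<in>\<T>. \<Sum>\<sigma>\<in>interior_edges \<Omega> K. edge_measure \<sigma> *
      (v_plus \<Omega> \<T> u du \<sigma> K * q K + v_minus \<Omega> \<T> u du \<sigma> K * q (neighbour \<T> \<sigma> K))) = 0"
  by (rule sum_antisymmetric_fluxes[OF assms])
    (simp add: mesh_neighbour[OF assms] v_plus_neighbour[OF assms] v_minus_neighbour[OF assms]
      algebra_simps)

text \<open>Discrete integration by parts: adding \<open>q K\<close> times the centred edge velocity
  to the centred gradient term leaves only a flux antisymmetric across the edge.\<close>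

lemma grad_duality:
  assumes mesh: "mesh \<Omega> \<T>"
  shows "(\<Sum>K\<in>\<T>. \<Sum>\<sigma>\<in>interior_edges \<Omega> K. edge_measure \<sigma> * (q K * edge_trace \<Omega> \<T> w \<sigma> K))
    = - (\<Sum>K\<in>\<T>. measure lebesgue K * (grad \<Omega> \<T> q K \<bullet> w K))"
proof -
  \<comment> \<open>With \<open>L\<close> the neighbour, \<open>(q L - q K) / 2\<close> times the
    normal part of \<open>w K\<close>, plus \<open>q K\<close> times the normal part of
    \<open>(w K + w L) / 2\<close>, is this mixed expression. It is symmetric in \<open>K\<close>
    and \<open>L\<close> apart from the sign of the normal.\<close>
  define f where "f K \<sigma> = edge_measure \<sigma> *
    ((q K * (w (neighbour \<T> \<sigma> K) \<bullet> outer_normal \<sigma> K)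
      + q (neighbour \<T> \<sigma> K) * (w K \<bullet> outer_normal \<sigma> K)) / 2)" for K \<sigma>
  have "measure lebesgue K * (grad \<Omega> \<T> q K \<bullet> w K) = (\<Sum>\<sigma>\<in>interior_edges \<Omega> K.
      f K \<sigma> - edge_measure \<sigma> * (q K * edge_trace \<Omega> \<T> w \<sigma> K))" if "K \<in> \<T>" for K
  proof -
    have "measure lebesgue K > 0"
      using that mesh by (auto simp: mesh_def intro: control_volume_measure_pos)
    then have "measure lebesgue K * (grad \<Omega> \<T> q K \<bullet> w K) = (\<Sum>\<sigma>\<in>interior_edges \<Omega> K.
        (edge_measure \<sigma> * ((q (neighbour \<T> \<sigma> K) - q K) / 2)) * (outer_normal \<sigma> K \<bullet> w K))"
      by (simp add: grad_def inner_sum_left)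
    also have "\<dots> = (\<Sum>\<sigma>\<in>interior_edges \<Omega> K.
        f K \<sigma> - edge_measure \<sigma> * (q K * edge_trace \<Omega> \<T> w \<sigma> K))"
      by (intro sum.cong refl)
        (simp add: f_def edge_trace_def inner_add_left inner_commute algebra_simps add_divide_distrib
          diff_divide_distrib)
    finally show ?thesis .
  qed
  moreover have "(\<Sum>K\<in>\<T>. \<Sum>\<sigma>\<in>interior_edges \<Omega> K. f K \<sigma>) = 0"
    by (rule sum_antisymmetric_fluxes[OF mesh])
      (simp add: f_def mesh_neighbour[OF mesh] algebra_simps)
  ultimately show ?thesis
    by (simp add: sum_subtractf)
qed

section \<open>Energy balance\<close>

lemma norm_weighted_sum_squared_le:
  fixes w :: "'i \<Rightarrow> 'v::real_inner"
  assumes "\<And>i. i \<in> I \<Longrightarrow> 0 \<le> f i"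
  shows "(norm (\<Sum>i\<in>I. f i *\<^sub>R w i))\<^sup>2 \<le> (\<Sum>i\<in>I. f i) * (\<Sum>i\<in>I. f i * (norm (w i))\<^sup>2)"
proof -
  have "norm (\<Sum>i\<in>I. f i *\<^sub>R w i) \<le> (\<Sum>i\<in>I. norm (f i *\<^sub>R w i))"
    by (rule norm_sum)
  \<comment> \<open>Splitting the weight into two square roots keeps one full factor
    \<open>f i\<close> in each sum after Cauchy-Schwarz.\<close>
  also have "\<dots> = (\<Sum>i\<in>I. sqrt (f i) * (sqrt (f i) * norm (w i)))"
    using assms by (intro sum.cong refl) (simp flip: mult.assoc)
  finally have "(norm (\<Sum>i\<in>I. f i *\<^sub>R w i))\<^sup>2 \<le> (\<Sum>i\<in>I. sqrt (f i) * (sqrt (f i) * norm (w i)))\<^sup>2"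
    by (intro power_mono) auto
  also have "\<dots> \<le> (\<Sum>i\<in>I. (sqrt (f i))\<^sup>2) * (\<Sum>i\<in>I. (sqrt (f i) * norm (w i))\<^sup>2)"
    by (rule Cauchy_Schwarz_ineq_sum)
  also have "\<dots> = (\<Sum>i\<in>I. f i) * (\<Sum>i\<in>I. f i * (norm (w i))\<^sup>2)"
    using assms by (simp add: power_mult_distrib cong: sum.cong)
  finally show ?thesis .
qed

text \<open>Here \<open>m\<close> is the cell measure, \<open>r'\<close> and \<open>v'\<close> are
  new values, \<open>r\<close> and \<open>v\<close> old ones, \<open>w i\<close> the old velocities
  of the neighbours, \<open>h i\<close> the outgoing and \<open>f i\<close> the incoming mass flux,
  and \<open>g\<close> the pressure gradient. The upwind dissipation contributes
  \<open>- dt / 2 * Q\<close>; the part of the explicit time error coming from \<open>X\<close> is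
  at most \<open>dt / 2 * Q\<close>, so the two cancel.\<close>

lemma kinetic_energy_cell:
  fixes v v' g :: "'v::real_inner" and w :: "'i \<Rightarrow> 'v"
  assumes m: "m > 0" and r': "r' > 0" and dt: "dt > 0"
    and f: "\<And>i. i \<in> I \<Longrightarrow> 0 \<le> f i"
    and mass: "m * (r' - r) + dt * (\<Sum>i\<in>I. h i - f i) = 0"
    and momentum: "m *\<^sub>R (r' *\<^sub>R v' - r *\<^sub>R v) + dt *\<^sub>R (\<Sum>i\<in>I. h i *\<^sub>R v - f i *\<^sub>R w i)
      + (dt * m) *\<^sub>R g = 0"
    and cfl: "2 * dt * (\<Sum>i\<in>I. f i) \<le> m * r'"
  shows "m * (1/2 * r' * (norm v')\<^sup>2 - 1/2 * r * (norm v)\<^sup>2)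
    \<le> - (dt / 2) * (\<Sum>i\<in>I. h i * (norm v)\<^sup>2 - f i * (norm (w i))\<^sup>2)
      - dt * m * (g \<bullet> v) + dt\<^sup>2 * m * (norm g)\<^sup>2 / r'"
proof -
  define X where "X = (\<Sum>i\<in>I. f i *\<^sub>R (w i - v))"
  define Q where "Q = (\<Sum>i\<in>I. f i * (norm (w i - v))\<^sup>2)"
  define S where "S = (\<Sum>i\<in>I. f i)"
  define H where "H = (\<Sum>i\<in>I. h i)"
  define W where "W = (\<Sum>i\<in>I. f i * (norm (w i))\<^sup>2)"
  define Y where "Y = (\<Sum>i\<in>I. f i *\<^sub>R w i)"
  define D where "D = v' - v"
  have X: "X = Y - S *\<^sub>R v"
    by (simp add: X_def Y_def S_def scaleR_diff_right sum_subtractf scaleR_sum_left)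
  have mass': "m * (r' - r) = - dt * (H - S)"
    using mass by (simp add: H_def S_def sum_subtractf)
  have "(\<Sum>i\<in>I. h i *\<^sub>R v - f i *\<^sub>R w i) = H *\<^sub>R v - Y"
    by (simp add: H_def Y_def sum_subtractf scaleR_sum_left)
  then have "m *\<^sub>R (r' *\<^sub>R v' - r *\<^sub>R v) = - (dt *\<^sub>R (H *\<^sub>R v - Y) + (dt * m) *\<^sub>R g)"
    using momentum by (simp only: eq_neg_iff_add_eq_0 add.assoc)
  \<comment> \<open>Subtracting \<open>v\<close> times the mass balance from the momentum balance
    isolates the velocity increment, driven by the jumps \<open>w i - v\<close> and by
    \<open>g\<close>.\<close>
  moreover have "(m * r') *\<^sub>R D = m *\<^sub>R (r' *\<^sub>R v' - r *\<^sub>R v) - (m * (r' - r)) *\<^sub>R v"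
    by (simp add: D_def algebra_simps)
  ultimately have "(m * r') *\<^sub>R D
      = - (dt *\<^sub>R (H *\<^sub>R v - Y) + (dt * m) *\<^sub>R g) - (- dt * (H - S)) *\<^sub>R v"
    by (simp only: mass')
  also have "\<dots> = dt *\<^sub>R (X - m *\<^sub>R g)"
    by (simp add: X algebra_simps)
  finally have D: "(m * r') *\<^sub>R D = dt *\<^sub>R (X - m *\<^sub>R g)" .
  have XS: "(norm X)\<^sup>2 \<le> S * Q"
    unfolding X_def S_def Q_def using f by (rule norm_weighted_sum_squared_le)
  have Q: "Q \<ge> 0" unfolding Q_def using f by (intro sum_nonneg) auto
  \<comment> \<open>Polarisation turns the jump term tested with \<open>v\<close> into a difference
    of squared speeds and the dissipation \<open>- Q\<close>.\<close>
  have polar: "2 * ((x - v) \<bullet> v) = (norm x)\<^sup>2 - (norm v)\<^sup>2 - (norm (x - v))\<^sup>2" for x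
    by (simp add: power2_norm_eq_inner inner_diff_left inner_diff_right inner_commute[of v x])
  have "2 * (X \<bullet> v) = (\<Sum>i\<in>I. f i * (2 * ((w i - v) \<bullet> v)))"
    by (simp add: X_def inner_sum_left sum_distrib_left mult.left_commute)
  also have "\<dots> = (\<Sum>i\<in>I. f i * (norm (w i))\<^sup>2 - f i * (norm v)\<^sup>2 - f i * (norm (w i - v))\<^sup>2)"
    by (simp only: polar right_diff_distrib)
  also have "\<dots> = W - S * (norm v)\<^sup>2 - Q"
    by (simp add: sum_subtractf sum_distrib_right W_def S_def Q_def)
  finally have XQ: "2 * (X \<bullet> v) = W - S * (norm v)\<^sup>2 - Q" .
  \<comment> \<open>The parallelogram identity separates the upwind part from the pressure part at
    the cost of a factor 2, the one built into the time step restriction.\<close>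
  have "(norm (X - m *\<^sub>R g))\<^sup>2 = 2 * (norm X)\<^sup>2 + 2 * (norm (m *\<^sub>R g))\<^sup>2 - (norm (X + m *\<^sub>R g))\<^sup>2"
    unfolding power2_norm_eq_inner inner_diff_left inner_diff_right inner_add_left inner_add_right
    by simp
  then have par: "(norm (X - m *\<^sub>R g))\<^sup>2 \<le> 2 * (norm X)\<^sup>2 + 2 * (m\<^sup>2 * (norm g)\<^sup>2)"
    using zero_le_power2[of "norm (X + m *\<^sub>R g)"]
    by (simp only: norm_scaleR power_mult_distrib power2_abs)
  \<comment> \<open>The extra factor \<open>m * r'\<close> makes the increment identity applicable
    and appears again on the right through \<open>cfl\<close>, so it can be cancelled at the
    end.\<close>
  have "(m * r') * (m * r' * (norm D)\<^sup>2) = (norm ((m * r') *\<^sub>R D))\<^sup>2"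
    by (simp add: power_mult_distrib power2_eq_square)
  also have "\<dots> = dt\<^sup>2 * (norm (X - m *\<^sub>R g))\<^sup>2"
    by (simp only: D norm_scaleR power_mult_distrib power2_abs)
  also have "\<dots> \<le> dt\<^sup>2 * (2 * (S * Q) + 2 * (m\<^sup>2 * (norm g)\<^sup>2))"
  proof (rule mult_left_mono)
    show "(norm (X - m *\<^sub>R g))\<^sup>2 \<le> 2 * (S * Q) + 2 * (m\<^sup>2 * (norm g)\<^sup>2)"
      using par XS by linarith
  qed simp
  also have "\<dots> = dt * ((2 * dt * S) * Q) + 2 * dt\<^sup>2 * m\<^sup>2 * (norm g)\<^sup>2"
    by algebra
  also have "\<dots> \<le> dt * ((m * r') * Q) + 2 * dt\<^sup>2 * m\<^sup>2 * (norm g)\<^sup>2"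
    using cfl Q dt by (intro add_right_mono mult_left_mono mult_right_mono) (auto simp: S_def)
  also have "\<dots> = (m * r') * (dt * Q + 2 * (dt\<^sup>2 * m * (norm g)\<^sup>2 / r'))"
    using r' by (simp add: distrib_left power2_eq_square)
  finally have DD: "m * r' * (norm D)\<^sup>2 \<le> dt * Q + 2 * (dt\<^sup>2 * m * (norm g)\<^sup>2 / r')"
    using mult_pos_pos[OF m r'] by (simp only: mult_le_cancel_left_pos)
  have Dv: "m * r' * (D \<bullet> v) = dt * (X \<bullet> v) - dt * m * (g \<bullet> v)"
    using arg_cong[OF D, of "\<lambda>z. z \<bullet> v"] by (simp add: inner_diff_left right_diff_distrib)
  have "v' = D + v" by (simp add: D_def)
  then have v': "(norm v')\<^sup>2 = (norm D)\<^sup>2 + 2 * (D \<bullet> v) + (norm v)\<^sup>2"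
    by (simp only: power2_norm_eq_inner inner_add_left inner_add_right inner_commute[of v D])
  \<comment> \<open>Three terms: the increment tested with the old velocity, the explicit time
    error, and the mass change carried at the old speed.\<close>
  have "m * (1/2 * r' * (norm v')\<^sup>2 - 1/2 * r * (norm v)\<^sup>2)
      = m * r' * (D \<bullet> v) + 1/2 * (m * r' * (norm D)\<^sup>2) + 1/2 * (m * (r' - r)) * (norm v)\<^sup>2"
    unfolding v' by (simp add: algebra_simps)
  also have "\<dots> \<le> dt * (X \<bullet> v) - dt * m * (g \<bullet> v) + 1/2 * (dt * Q + 2 * (dt\<^sup>2 * m * (norm g)\<^sup>2 / r'))
      + 1/2 * (- dt * (H - S)) * (norm v)\<^sup>2"
    unfolding Dv mass' using DD by (intro add_right_mono add_left_mono mult_left_mono) auto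
  also have "dt * (X \<bullet> v) = dt / 2 * (W - S * (norm v)\<^sup>2 - Q)"
    using arg_cong[OF XQ, of "\<lambda>z. dt / 2 * z"] by simp
  finally have "m * (1/2 * r' * (norm v')\<^sup>2 - 1/2 * r * (norm v)\<^sup>2)
      \<le> - (dt / 2) * (H * (norm v)\<^sup>2 - W) - dt * m * (g \<bullet> v) + dt\<^sup>2 * m * (norm g)\<^sup>2 / r'"
    by (simp add: algebra_simps)
  moreover have "(\<Sum>i\<in>I. h i * (norm v)\<^sup>2 - f i * (norm (w i))\<^sup>2) = H * (norm v)\<^sup>2 - W"
    by (simp add: sum_subtractf H_def W_def sum_distrib_right)
  ultimately show ?thesis by simp
qed

section \<open>Internal energy: relation to the pressure and convexity\<close>

definition psi_deriv :: "real \<Rightarrow> real \<Rightarrow> real \<Rightarrow> real" where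
  "psi_deriv a \<gamma> r = a * \<gamma> / (\<gamma> - 1) * r powr (\<gamma> - 1)"

text \<open>From \<open>\<gamma> / (\<gamma> - 1) = 1 / (\<gamma> - 1) + 1\<close>. It splits an
  outgoing mass flux tested with the derivative of \<open>psi\<close> into a flux of internal energy
  and a work of pressure.\<close>

lemma psi_deriv_mult_self:
  assumes "\<gamma> > 1" "r > 0"
  shows "psi_deriv a \<gamma> r * r = psi a \<gamma> r + pressure a \<gamma> r"
proof -
  have "r powr (\<gamma> - 1) * r = r powr \<gamma>"
    using assms(2) by (simp add: powr_diff)
  then have "psi_deriv a \<gamma> r * r = a * \<gamma> / (\<gamma> - 1) * r powr \<gamma>"
    by (simp add: psi_deriv_def)
  also have "\<dots> = psi a \<gamma> r + pressure a \<gamma> r"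
    using assms(1) by (simp add: psi_def pressure_def field_simps)
  finally show ?thesis .
qed

text \<open>Convexity of the power function with exponent \<open>\<gamma>\<close>, scaled by
  \<open>a / (\<gamma> - 1) > 0\<close>. It serves both the implicit time difference and the upwind
  differences in space.\<close>

lemma psi_above_tangent:
  assumes "a > 0" "\<gamma> > 1" "r > 0" "s > 0"
  shows "psi_deriv a \<gamma> r * (s - r) \<le> psi a \<gamma> s - psi a \<gamma> r"
proof -
  have "(\<gamma> * r powr (\<gamma> - 1)) * (s - r) \<le> s powr \<gamma> - r powr \<gamma>"
    using assms
    by (intro convex_on_imp_above_tangent[OF powr_convex])
      (auto intro!: derivative_eq_intros simp: interior_open)
  then have "a / (\<gamma> - 1) * ((\<gamma> * r powr (\<gamma> - 1)) * (s - r)) \<le> a / (\<gamma> - 1) * (s powr \<gamma> - r powr \<gamma>)"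
    using assms by (intro mult_left_mono) auto
  then show ?thesis by (simp add: psi_deriv_def psi_def mult.assoc right_diff_distrib)
qed


text \<open>The cell estimates \<open>kin\<close> and \<open>pot\<close> are added and summed over
  the mesh. The assumption \<open>cfl\<close> is the time step restriction multiplied out, which
  also covers a vanishing inflow.\<close>

lemma energy_step:
  fixes u u' :: "(real^'d) set \<Rightarrow> real^'d"
  assumes mesh: "mesh \<Omega> \<T>" and a: "a > 0" and \<gamma>: "\<gamma> > 1" and dt: "dt > 0"
    and du: "du = velocity_correction \<Omega> \<T> a \<gamma> \<eta> dt r'"
    and G: "G = pressure_grad \<Omega> \<T> a \<gamma> r'"
    and r: "\<And>K. K \<in> \<T> \<Longrightarrow> r K > 0" and r': "\<And>K. K \<in> \<T> \<Longrightarrow> r' K > 0"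
    and mass: "\<And>K. K \<in> \<T> \<Longrightarrow> (1 / dt) * (r' K - r K) + div_up \<Omega> \<T> r' u du K = 0"
    and momentum: "\<And>K. K \<in> \<T> \<Longrightarrow> (1 / dt) *\<^sub>R (r' K *\<^sub>R u' K - r K *\<^sub>R u K)
      + div_up \<Omega> \<T> (\<lambda>L. r' L *\<^sub>R u L) u du K + G K = 0"
    and cfl: "\<And>K. K \<in> \<T> \<Longrightarrow> 2 * dt * (\<Sum>\<sigma>\<in>interior_edges \<Omega> K. edge_measure \<sigma> *
      (- (r' (neighbour \<T> \<sigma> K) * v_minus \<Omega> \<T> u du \<sigma> K))) \<le> measure lebesgue K * r' K"
  shows "(\<Sum>K\<in>\<T>. measure lebesgue K * energy a \<gamma> (r' K) (u' K))
      + dt\<^sup>2 * (\<Sum>K\<in>\<T>. measure lebesgue K * (\<eta> - 1 / r' K) * (norm (G K))\<^sup>2)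
    \<le> (\<Sum>K\<in>\<T>. measure lebesgue K * energy a \<gamma> (r K) (u K))"
proof -
  let ?m = "measure (lebesgue :: (real^'d) measure)"
  define N where "N K \<sigma> = neighbour \<T> \<sigma> K" for K \<sigma>
  define vp where "vp K \<sigma> = v_plus \<Omega> \<T> u du \<sigma> K" for K \<sigma>
  define vm where "vm K \<sigma> = v_minus \<Omega> \<T> u du \<sigma> K" for K \<sigma>
  define p where "p K = pressure a \<gamma> (r' K)" for K
  define \<psi> where "\<psi> K = psi a \<gamma> (r' K)" for K
  define flux where "flux q K = (\<Sum>\<sigma>\<in>interior_edges \<Omega> K.
    edge_measure \<sigma> * (vp K \<sigma> * q K + vm K \<sigma> * q (N K \<sigma>)))" for q :: "(real^'d) set \<Rightarrow> real" and K
  \<comment> \<open>The pressure work of \<open>w\<close> through the edges of a cell; after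
    summation, duality makes it the work of the pressure gradient with opposite sign.\<close>
  define work where "work w K = (\<Sum>\<sigma>\<in>interior_edges \<Omega> K.
    edge_measure \<sigma> * (p K * edge_trace \<Omega> \<T> w \<sigma> K))" for w K
  have m: "?m K > 0" if "K \<in> \<T>" for K
    using that mesh by (auto simp: mesh_def intro: control_volume_measure_pos)
  have N: "N K \<sigma> \<in> \<T>" if "K \<in> \<T>" "\<sigma> \<in> interior_edges \<Omega> K" for K \<sigma>
    using mesh_neighbour(1)[OF mesh that] by (simp add: N_def)
  have flux0: "(\<Sum>K\<in>\<T>. flux q K) = 0" for q
    unfolding flux_def vp_def vm_def N_def by (rule sum_upwind_fluxes[OF mesh])
  have work: "(\<Sum>K\<in>\<T>. work w K) = - (\<Sum>K\<in>\<T>. ?m K * (G K \<bullet> w K))" for w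
    unfolding work_def grad_duality[OF mesh] G pressure_grad_def p_def ..
  have mass': "?m K * (r' K - r K) = - dt * flux r' K" if "K \<in> \<T>" for K
    using mass[OF that] m[OF that] dt
    by (simp add: div_up_def flux_def vp_def vm_def N_def field_simps)
  have kin: "?m K * (1/2 * r' K * (norm (u' K))\<^sup>2 - 1/2 * r K * (norm (u K))\<^sup>2)
      \<le> - (dt / 2) * flux (\<lambda>L. r' L * (norm (u L))\<^sup>2) K - dt * ?m K * (G K \<bullet> u K)
        + dt\<^sup>2 * ?m K * (norm (G K))\<^sup>2 / r' K" if K: "K \<in> \<T>" for K
  proof -
    define h where "h \<sigma> = edge_measure \<sigma> * (vp K \<sigma> * r' K)" for \<sigma>
    define f where "f \<sigma> = edge_measure \<sigma> * (- (r' (N K \<sigma>) * vm K \<sigma>))" for \<sigma>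
    have "(dt * ?m K) *\<^sub>R ((1 / dt) *\<^sub>R (r' K *\<^sub>R u' K - r K *\<^sub>R u K)
      + div_up \<Omega> \<T> (\<lambda>L. r' L *\<^sub>R u L) u du K + G K) = 0"
      by (simp only: momentum[OF K] scaleR_zero_right)
    moreover have "(dt * ?m K) *\<^sub>R div_up \<Omega> \<T> (\<lambda>L. r' L *\<^sub>R u L) u du K
      = dt *\<^sub>R (\<Sum>\<sigma>\<in>interior_edges \<Omega> K. h \<sigma> *\<^sub>R u K - f \<sigma> *\<^sub>R u (N K \<sigma>))"
      using m[OF K]
      by (simp add: div_up_def h_def f_def vp_def vm_def N_def scaleR_add_right mult_ac)
    ultimately have momentum': "?m K *\<^sub>R (r' K *\<^sub>R u' K - r K *\<^sub>R u K)
      + dt *\<^sub>R (\<Sum>\<sigma>\<in>interior_edges \<Omega> K. h \<sigma> *\<^sub>R u K - f \<sigma> *\<^sub>R u (N K \<sigma>)) + (dt * ?m K) *\<^sub>R G K = 0"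
      using dt by (simp add: scaleR_add_right)
    have f: "0 \<le> f \<sigma>" if "\<sigma> \<in> interior_edges \<Omega> K" for \<sigma>
      unfolding f_def vm_def
      using edge_measure_nonneg[of \<sigma>] r'[OF N[OF K that]] v_minus_nonpos[of \<Omega> \<T> u du \<sigma> K]
      by (intro mult_nonneg_nonneg) (auto simp: mult_nonneg_nonpos)
    have "flux r' K = (\<Sum>\<sigma>\<in>interior_edges \<Omega> K. h \<sigma> - f \<sigma>)"
      by (simp add: flux_def h_def f_def algebra_simps)
    then have "?m K * (r' K - r K) + dt * (\<Sum>\<sigma>\<in>interior_edges \<Omega> K. h \<sigma> - f \<sigma>) = 0"
      using mass'[OF K] by simp
    moreover have "2 * dt * (\<Sum>\<sigma>\<in>interior_edges \<Omega> K. f \<sigma>) \<le> ?m K * r' K"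
      using cfl[OF K] by (simp add: f_def N_def vm_def)
    ultimately have "?m K * (1/2 * r' K * (norm (u' K))\<^sup>2 - 1/2 * r K * (norm (u K))\<^sup>2)
      \<le> - (dt / 2) * (\<Sum>\<sigma>\<in>interior_edges \<Omega> K. h \<sigma> * (norm (u K))\<^sup>2 - f \<sigma> * (norm (u (N K \<sigma>)))\<^sup>2)
        - dt * ?m K * (G K \<bullet> u K) + dt\<^sup>2 * ?m K * (norm (G K))\<^sup>2 / r' K"
      by (intro kinetic_energy_cell momentum' m[OF K] r'[OF K] dt f)
    then show ?thesis
      by (simp add: flux_def h_def f_def algebra_simps)
  qed
  have pot: "?m K * (psi a \<gamma> (r' K) - psi a \<gamma> (r K))
      \<le> - dt * (work u K - work du K + flux \<psi> K)" if K: "K \<in> \<T>" for K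
  proof -
    let ?d = "psi_deriv a \<gamma> (r' K)"
    have dK: "?d * r' K = \<psi> K + p K"
      unfolding \<psi>_def p_def by (rule psi_deriv_mult_self[OF \<gamma> r'[OF K]])
    \<comment> \<open>The outgoing part is an equality by \<open>dK\<close>. In the incoming part
      the tangent at \<open>r' K\<close> is compared with the neighbouring density, and the factor
      \<open>vm K \<sigma> \<le> 0\<close> turns the inequality around.\<close>
    have "edge_measure \<sigma> * (p K * (edge_trace \<Omega> \<T> u \<sigma> K - edge_trace \<Omega> \<T> du \<sigma> K)
        + (vp K \<sigma> * \<psi> K + vm K \<sigma> * \<psi> (N K \<sigma>)))
      \<le> edge_measure \<sigma> * (?d * (vp K \<sigma> * r' K + vm K \<sigma> * r' (N K \<sigma>)))"
      if \<sigma>: "\<sigma> \<in> interior_edges \<Omega> K" for \<sigma>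
    proof (rule mult_left_mono[OF _ edge_measure_nonneg])
      have "?d * (r' (N K \<sigma>) - r' K) \<le> \<psi> (N K \<sigma>) - \<psi> K"
        unfolding \<psi>_def by (rule psi_above_tangent[OF a \<gamma> r'[OF K] r'[OF N[OF K \<sigma>]]])
      then have "?d * r' (N K \<sigma>) \<le> p K + \<psi> (N K \<sigma>)"
        using dK by (simp add: algebra_simps)
      then have "vm K \<sigma> * (p K + \<psi> (N K \<sigma>)) \<le> vm K \<sigma> * (?d * r' (N K \<sigma>))"
        unfolding vm_def by (intro mult_left_mono_neg v_minus_nonpos)
      moreover have "vp K \<sigma> * (?d * r' K) = vp K \<sigma> * (\<psi> K + p K)"
        by (simp only: dK)
      ultimately have "p K * (vp K \<sigma> + vm K \<sigma>) + (vp K \<sigma> * \<psi> K + vm K \<sigma> * \<psi> (N K \<sigma>))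
        \<le> ?d * (vp K \<sigma> * r' K + vm K \<sigma> * r' (N K \<sigma>))"
        by (simp add: algebra_simps)
      then show "p K * (edge_trace \<Omega> \<T> u \<sigma> K - edge_trace \<Omega> \<T> du \<sigma> K)
          + (vp K \<sigma> * \<psi> K + vm K \<sigma> * \<psi> (N K \<sigma>))
        \<le> ?d * (vp K \<sigma> * r' K + vm K \<sigma> * r' (N K \<sigma>))"
        by (simp add: vp_def vm_def v_plus_add_v_minus)
    qed
    then have "work u K - work du K + flux \<psi> K \<le> ?d * flux r' K"
      unfolding work_def flux_def sum_distrib_left sum_subtractf[symmetric] sum.distrib[symmetric]
      by (intro sum_mono) (simp add: algebra_simps)
    then have "dt * (work u K - work du K + flux \<psi> K) \<le> dt * (?d * flux r' K)"
      using dt by (intro mult_left_mono) auto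
    \<comment> \<open>The tangent is taken at the new density, so the old value lies above it and
      the implicit time difference has the favourable sign.\<close>
    moreover have "?d * (r K - r' K) \<le> psi a \<gamma> (r K) - psi a \<gamma> (r' K)"
      by (rule psi_above_tangent[OF a \<gamma> r'[OF K] r[OF K]])
    then have "?m K * (?d * (r K - r' K)) \<le> ?m K * (psi a \<gamma> (r K) - psi a \<gamma> (r' K))"
      using m[OF K] by (intro mult_left_mono) auto
    moreover have "?m K * (?d * (r K - r' K)) = dt * (?d * flux r' K)"
      using arg_cong[OF mass'[OF K], of "\<lambda>z. - ?d * z"] by (simp add: algebra_simps)
    ultimately show ?thesis by (simp add: algebra_simps)
  qed
  have "?m K * energy a \<gamma> (r' K) (u' K) - ?m K * energy a \<gamma> (r K) (u K)
      \<le> - (dt / 2) * flux (\<lambda>L. r' L * (norm (u L))\<^sup>2) K - dt * (?m K * (G K \<bullet> u K))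
        + dt\<^sup>2 * (?m K * (norm (G K))\<^sup>2 / r' K)
        - dt * work u K + dt * work du K - dt * flux \<psi> K" if "K \<in> \<T>" for K
    using kin[OF that] pot[OF that] by (simp add: energy_def algebra_simps)
  then have "(\<Sum>K\<in>\<T>. ?m K * energy a \<gamma> (r' K) (u' K) - ?m K * energy a \<gamma> (r K) (u K))
      \<le> (\<Sum>K\<in>\<T>. - (dt / 2) * flux (\<lambda>L. r' L * (norm (u L))\<^sup>2) K - dt * (?m K * (G K \<bullet> u K))
        + dt\<^sup>2 * (?m K * (norm (G K))\<^sup>2 / r' K)
        - dt * work u K + dt * work du K - dt * flux \<psi> K)"
    by (rule sum_mono)
  also have "\<dots> = - (dt / 2) * (\<Sum>K\<in>\<T>. flux (\<lambda>L. r' L * (norm (u L))\<^sup>2) K)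
      - dt * (\<Sum>K\<in>\<T>. ?m K * (G K \<bullet> u K)) + dt\<^sup>2 * (\<Sum>K\<in>\<T>. ?m K * (norm (G K))\<^sup>2 / r' K)
      - dt * (\<Sum>K\<in>\<T>. work u K) + dt * (\<Sum>K\<in>\<T>. work du K) - dt * (\<Sum>K\<in>\<T>. flux \<psi> K)"
    by (simp only: sum.distrib sum_subtractf sum_distrib_left)
  \<comment> \<open>Fluxes vanish by conservativity; by duality the work of \<open>u\<close> cancels
    the term \<open>G K \<bullet> u K\<close> of the momentum equation, and only the work of the
    correction \<open>du\<close> survives.\<close>
  also have "\<dots> = dt\<^sup>2 * (\<Sum>K\<in>\<T>. ?m K * (norm (G K))\<^sup>2 / r' K) - dt * (\<Sum>K\<in>\<T>. ?m K * (G K \<bullet> du K))"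
    by (simp add: flux0 work)
  \<comment> \<open>The correction is \<open>\<eta> * dt\<close> times \<open>G K\<close>, so its
    work is quadratic in the pressure gradient, with the same factor \<open>dt\<^sup>2\<close> as
    the time error.\<close>
  also have "dt * (\<Sum>K\<in>\<T>. ?m K * (G K \<bullet> du K)) = dt\<^sup>2 * (\<Sum>K\<in>\<T>. ?m K * \<eta> * (norm (G K))\<^sup>2)"
    by (simp add: du velocity_correction_def G sum_distrib_left power2_norm_eq_inner mult_ac
        power2_eq_square[of dt])
  finally show ?thesis
    by (simp add: sum_subtractf algebra_simps)
qed

section \<open>Initial energy\<close>

text \<open>Convex cells have negligible frontiers, so measures can be added over the disjoint
  interiors. The bound depends on the domain alone and makes the final constant independent of the
  mesh.\<close>

lemma sum_measure_cells_le:
  assumes mesh: "mesh \<Omega> \<T>" and "bounded \<Omega>"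
  shows "(\<Sum>K\<in>\<T>. measure lebesgue K) \<le> measure lebesgue (closure \<Omega>)"
proof -
  have "measure lebesgue K = measure lebesgue (interior K)" if "K \<in> \<T>" for K
  proof -
    have "control_volume K" using that mesh by (simp add: mesh_def)
    then have "polytope K" by (rule control_volume_polytope)
    then show ?thesis
      by (intro measure_interior[symmetric] polytope_imp_bounded negligible_convex_frontier
          polytope_imp_convex)
  qed
  then have "(\<Sum>K\<in>\<T>. measure lebesgue K) = (\<Sum>K\<in>\<T>. measure lebesgue (interior K))"
    by simp
  also have "\<dots> = measure lebesgue (\<Union>K\<in>\<T>. interior K)"
  proof (rule measure_finite_Union[symmetric])
    show "emeasure lebesgue (interior K) \<noteq> \<infinity>" if "K \<in> \<T>" for K
    proof -
      have "polytope K" using that mesh by (simp add: mesh_def control_volume_polytope)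
      then have "interior K \<in> lmeasurable"
        by (intro bounded_set_imp_lmeasurable bounded_interior polytope_imp_bounded) auto
      then show ?thesis unfolding infinity_ennreal_def by (rule fmeasurableD2)
    qed
  qed (use mesh in \<open>auto simp: mesh_def disjoint_family_on_def\<close>)
  also have "\<dots> \<le> measure lebesgue (closure \<Omega>)"
  proof (rule measure_mono_fmeasurable)
    have "closure \<Omega> = \<Union>\<T>" using mesh by (simp add: mesh_def)
    then show "(\<Union>K\<in>\<T>. interior K) \<subseteq> closure \<Omega>" using interior_subset by blast
    show "closure \<Omega> \<in> lmeasurable"
      using assms(2) by (intro lmeasurable_compact) (simp add: compact_closure)
    show "(\<Union>K\<in>\<T>. interior K) \<in> sets lebesgue"
      using mesh by (intro sets.finite_UN) (auto simp: mesh_def)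
  qed
  finally show ?thesis .
qed

text \<open>The mean integrates over \<open>K \<inter> \<Omega>\<close> but divides by the measure
  of \<open>K\<close>. As \<open>B \<ge> 0\<close>, the integrand is dominated by \<open>B\<close>
  on all of \<open>K\<close>.\<close>

lemma norm_cell_mean_le:
  fixes f :: "real^'d \<Rightarrow> 'b::euclidean_space"
  assumes "K \<in> lmeasurable" "measure lebesgue K > 0" "\<Omega> \<in> sets lebesgue" "B \<ge> 0"
    and "AE x in lebesgue_on \<Omega>. norm (f x) \<le> B"
  shows "norm (cell_mean \<Omega> f K) \<le> B"
proof -
  define g where "g x = indicator (K \<inter> \<Omega>) x *\<^sub>R f x" for x
  have "norm (integral\<^sup>L lebesgue g) \<le> B * measure lebesgue K"
  proof (cases "integrable lebesgue g")
    case True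
    have "norm (integral\<^sup>L lebesgue g) \<le> integral\<^sup>L lebesgue (\<lambda>x. norm (g x))"
      by (rule integral_norm_bound)
    also have "\<dots> \<le> integral\<^sup>L lebesgue (\<lambda>x. B * indicator K x)"
    proof (rule integral_mono_AE)
      show "AE x in lebesgue. norm (g x) \<le> B * indicator K x"
        using assms(5) unfolding AE_restrict_space_iff[of \<Omega> lebesgue, simplified, OF assms(3)]
        by eventually_elim (auto simp: g_def indicator_def assms(4))
    qed (use True assms(1) in \<open>auto simp: integrable_indicator_iff fmeasurable_def\<close>)
    also have "\<dots> = B * measure lebesgue K"
      by simp
    finally show ?thesis .
  next
    \<comment> \<open>The Bochner integral of a non-integrable function is 0 by convention, which
      satisfies the bound.\<close>
    case False
    then show ?thesis using assms by (simp add: not_integrable_integral_eq)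
  qed
  then show ?thesis
    using assms(2)
    by (simp add: cell_mean_def set_lebesgue_integral_def g_def[symmetric] field_simps)
qed

section \<open>Energy bound uniform in the discretization\<close>

theorem theorem1p15:
  fixes \<Omega> :: "(real^'d) set" and a \<gamma> Tend :: real
    and \<rho>0 :: "real^'d \<Rightarrow> real" and u0 :: "real^'d \<Rightarrow> real^'d"
  assumes "CARD('d) \<in> {1, 2, 3}"
    and "admissible_domain \<Omega>"
    and "a > 0" and "\<gamma> > 1" and "Tend > 0"
    and "L_infinity \<Omega> \<rho>0" and "AE x in lebesgue_on \<Omega>. \<rho>0 x > 0"
    and "L_infinity \<Omega> u0"
  shows "\<exists>C>0. \<forall>(\<T> :: (real^'d) set set) (N :: nat) (\<delta>t :: real) (\<eta> :: real)
           (\<rho> :: nat \<Rightarrow> (real^'d) set \<Rightarrow> real) (u :: nat \<Rightarrow> (real^'d) set \<Rightarrow> real^'d).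
     mesh \<Omega> \<T> \<and> \<delta>t > 0 \<and> real N * \<delta>t = Tend \<and> \<eta> > 0 \<and>
     discrete_solution \<Omega> \<T> a \<gamma> \<eta> \<delta>t N \<rho>0 u0 \<rho> u \<and>
     (\<forall>n<N. \<forall>K\<in>\<T>. \<eta> \<ge> 1 / \<rho> (Suc n) K) \<and>
     (\<forall>n<N. \<forall>K\<in>\<T>.
        (let S = \<Sum>\<sigma>\<in>interior_edges \<Omega> K.
                   edge_measure \<sigma> * (- mass_flux_minus \<Omega> \<T> a \<gamma> \<eta> \<delta>t (\<rho> (Suc n)) (u n) \<sigma> K)
         in S \<noteq> 0 \<longrightarrow> \<delta>t \<le> measure lebesgue K * \<rho> (Suc n) K / (2 * S)))
     \<longrightarrow>
     (\<forall>n\<in>{1..N}.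
        (\<Sum>K\<in>\<T>. measure lebesgue K * energy a \<gamma> (\<rho> n K) (u n K))
        + (\<Sum>r<n. \<delta>t\<^sup>2 * (\<Sum>K\<in>\<T>. measure lebesgue K * (\<eta> - 1 / \<rho> (Suc r) K)
                                 * (norm (pressure_grad \<Omega> \<T> a \<gamma> (\<rho> (Suc r)) K))\<^sup>2))
        \<le> C)"
proof -
  obtain B0 where "AE x in lebesgue_on \<Omega>. norm (\<rho>0 x) \<le> B0"
    using assms(6) by (auto simp: L_infinity_def)
  then have R: "AE x in lebesgue_on \<Omega>. norm (\<rho>0 x) \<le> \<bar>B0\<bar>"
    by eventually_elim auto
  obtain B1 where "AE x in lebesgue_on \<Omega>. norm (u0 x) \<le> B1"
    using assms(8) by (auto simp: L_infinity_def)
  then have V: "AE x in lebesgue_on \<Omega>. norm (u0 x) \<le> \<bar>B1\<bar>"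
    by eventually_elim auto
  have \<Omega>: "bounded \<Omega>" "\<Omega> \<in> sets lebesgue"
    using assms(2) by (auto simp: admissible_domain_def)
  \<comment> \<open>The energy density at the bounds of the data, which dominates the initial energy
    of every cell; absolute values make both bounds nonnegative.\<close>
  define e0 where "e0 = 1/2 * \<bar>B0\<bar> * \<bar>B1\<bar>\<^sup>2 + psi a \<gamma> \<bar>B0\<bar>"
  have e0: "e0 \<ge> 0"
    using assms(3,4) by (simp add: e0_def psi_def)
  \<comment> \<open>The summand 1 guarantees strict positivity.\<close>
  define C where "C = e0 * measure lebesgue (closure \<Omega>) + 1"
  have C: "C > 0" using e0 by (simp add: C_def add_nonneg_pos)
  show ?thesis
  proof (intro exI[of _ C] conjI C allI impI ballI, elim conjE)
    fix \<T> :: "(real^'d) set set" and N :: nat and \<delta>t \<eta> :: real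
      and \<rho> :: "nat \<Rightarrow> (real^'d) set \<Rightarrow> real" and u :: "nat \<Rightarrow> (real^'d) set \<Rightarrow> real^'d" and n :: nat
    assume mesh: "mesh \<Omega> \<T>" and dt: "\<delta>t > 0"
      and sol: "discrete_solution \<Omega> \<T> a \<gamma> \<eta> \<delta>t N \<rho>0 u0 \<rho> u"
      and cfl: "\<forall>n<N. \<forall>K\<in>\<T>.
        (let S = \<Sum>\<sigma>\<in>interior_edges \<Omega> K.
                   edge_measure \<sigma> * (- mass_flux_minus \<Omega> \<T> a \<gamma> \<eta> \<delta>t (\<rho> (Suc n)) (u n) \<sigma> K)
         in S \<noteq> 0 \<longrightarrow> \<delta>t \<le> measure lebesgue K * \<rho> (Suc n) K / (2 * S))"
      and n: "n \<in> {1..N}"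
    define E where "E n = (\<Sum>K\<in>\<T>. measure lebesgue K * energy a \<gamma> (\<rho> n K) (u n K))" for n
    define D where "D r = \<delta>t\<^sup>2 * (\<Sum>K\<in>\<T>. measure lebesgue K * (\<eta> - 1 / \<rho> (Suc r) K)
      * (norm (pressure_grad \<Omega> \<T> a \<gamma> (\<rho> (Suc r)) K))\<^sup>2)" for r
    have cv: "control_volume K" if "K \<in> \<T>" for K
      using mesh that by (simp add: mesh_def)
    have pos: "\<rho> n K > 0" if "n \<le> N" "K \<in> \<T>" for n K
      using sol that by (simp add: discrete_solution_def)
    have step: "E (Suc n) + D n \<le> E n" if n: "n < N" for n
      unfolding E_def D_def
    proof (rule energy_step[OF mesh assms(3,4) dt refl refl])
      fix K assume K: "K \<in> \<T>"
      show "\<rho> n K > 0" "\<rho> (Suc n) K > 0" using pos K n by auto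
      let ?du = "velocity_correction \<Omega> \<T> a \<gamma> \<eta> \<delta>t (\<rho> (Suc n))"
      show "1 / \<delta>t * (\<rho> (Suc n) K - \<rho> n K) + div_up \<Omega> \<T> (\<rho> (Suc n)) (u n) ?du K = 0"
        "(1 / \<delta>t) *\<^sub>R (\<rho> (Suc n) K *\<^sub>R u (Suc n) K - \<rho> n K *\<^sub>R u n K)
          + div_up \<Omega> \<T> (\<lambda>L. \<rho> (Suc n) L *\<^sub>R u n L) (u n) ?du K
          + pressure_grad \<Omega> \<T> a \<gamma> (\<rho> (Suc n)) K = 0"
        using sol n K unfolding discrete_solution_def Let_def by blast+
      define S where "S = (\<Sum>\<sigma>\<in>interior_edges \<Omega> K. edge_measure \<sigma> *
        (- (\<rho> (Suc n) (neighbour \<T> \<sigma> K) * v_minus \<Omega> \<T> (u n) ?du \<sigma> K)))"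
      have S_cfl: "S \<noteq> 0 \<Longrightarrow> \<delta>t \<le> measure lebesgue K * \<rho> (Suc n) K / (2 * S)"
        using cfl[rule_format, OF n K] by (simp add: Let_def mass_flux_minus_def S_def)
      have "S \<ge> 0"
        unfolding S_def
      proof (rule sum_nonneg)
        fix \<sigma> assume "\<sigma> \<in> interior_edges \<Omega> K"
        then have "\<rho> (Suc n) (neighbour \<T> \<sigma> K) > 0"
          using pos mesh_neighbour(1)[OF mesh K] n by auto
        then show "0 \<le> edge_measure \<sigma> *
          (- (\<rho> (Suc n) (neighbour \<T> \<sigma> K) * v_minus \<Omega> \<T> (u n) ?du \<sigma> K))"
          using v_minus_nonpos[of \<Omega> \<T> "u n" ?du \<sigma> K]
          by (intro mult_nonneg_nonneg edge_measure_nonneg) (auto simp: mult_nonneg_nonpos)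
      qed
      \<comment> \<open>For \<open>S = 0\<close> the quotient form of the restriction is silent, but
        then the left side is zero and the right side positive.\<close>
      have "2 * \<delta>t * S \<le> measure lebesgue K * \<rho> (Suc n) K"
      proof (cases "S = 0")
        case True
        then show ?thesis
          using pos[of "Suc n" K] n K by (simp add: less_imp_le)
      next
        case False
        then have "S > 0" using \<open>S \<ge> 0\<close> by simp
        then show ?thesis using S_cfl[OF False] by (simp add: field_simps)
      qed
      then show "2 * \<delta>t * (\<Sum>\<sigma>\<in>interior_edges \<Omega> K. edge_measure \<sigma> *
          (- (\<rho> (Suc n) (neighbour \<T> \<sigma> K) * v_minus \<Omega> \<T> (u n) ?du \<sigma> K)))
        \<le> measure lebesgue K * \<rho> (Suc n) K"
        by (simp only: S_def)
    qed
    \<comment> \<open>The one-step estimates telescope from level 0, where the dissipation sum is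
      empty.\<close>
    have "E n + (\<Sum>r<n. D r) \<le> E 0" if "n \<le> N" for n
      using that
    proof (induction n)
      case (Suc n)
      then show ?case using step[of n] by simp
    qed simp
    then have "E n + (\<Sum>r<n. D r) \<le> E 0" using n by simp
    also have "E 0 \<le> (\<Sum>K\<in>\<T>. measure lebesgue K * e0)"
      unfolding E_def
    proof (intro sum_mono mult_left_mono)
      fix K assume K: "K \<in> \<T>"
      have init: "\<rho> 0 K = cell_mean \<Omega> \<rho>0 K" "u 0 K = cell_mean \<Omega> u0 K"
        using sol K by (auto simp: discrete_solution_def)
      have "0 < \<rho> 0 K" using pos K by simp
      moreover have "\<rho> 0 K \<le> \<bar>B0\<bar>"
        using norm_cell_mean_le[OF control_volume_measure_pos[OF cv[OF K]] \<Omega>(2) _ R] init by simp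
      moreover have "norm (u 0 K) \<le> \<bar>B1\<bar>"
        using norm_cell_mean_le[OF control_volume_measure_pos[OF cv[OF K]] \<Omega>(2) _ V] init by simp
      \<comment> \<open>For positive density the energy is increasing in density and in speed, so
        the bounds on the cell means can be inserted.\<close>
      ultimately show "energy a \<gamma> (\<rho> 0 K) (u 0 K) \<le> e0"
        unfolding energy_def e0_def psi_def using assms(3,4)
        by (intro add_mono mult_mono power_mono powr_mono2) auto
    qed simp
    also have "\<dots> = e0 * (\<Sum>K\<in>\<T>. measure lebesgue K)"
      by (simp add: sum_distrib_left mult.commute)
    also have "\<dots> \<le> C"
      using mult_left_mono[OF sum_measure_cells_le[OF mesh \<Omega>(1)] e0] by (simp add: C_def)
    finally show "(\<Sum>K\<in>\<T>. measure lebesgue K * energy a \<gamma> (\<rho> n K) (u n K))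
        + (\<Sum>r<n. \<delta>t\<^sup>2 * (\<Sum>K\<in>\<T>. measure lebesgue K * (\<eta> - 1 / \<rho> (Suc r) K)
                                 * (norm (pressure_grad \<Omega> \<T> a \<gamma> (\<rho> (Suc r)) K))\<^sup>2)) \<le> C"
      by (simp only: E_def D_def)
  qed
qed

end
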